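(* Let $R\in\mathbb{R}$, let $\mathcal{H}$ be a complex Hilbert space of finite dimension $n$, and let $\Psi:\mathcal{A}(R)\to\mathcal{L}(\mathcal{H},\mathcal{H})\cong M_n(\mathbb{C})$ be an irreducible adjoint-preserving representation such that $\Psi(\boldsymbol{\varepsilon})=\varepsilon\,\mathrm{Id}$ for some real $\varepsilon>0$ and such that $\Psi(\mathbf{u})$ has no multiple eigenvalues. Let $\alpha$ be given by $\tan(\tfrac12\alpha)=\varepsilon$, $0<\alpha<\pi$. Then there exist $\beta\in\mathbb{R}$ and an orthonormal basis of $\mathcal{H}$ consisting of eigenvectors of $\Psi(\mathbf{u})$, labelled $$|\beta\rangle,\ |\beta+\alpha\rangle,\ |\beta+2\alpha\rangle,\ \ldots,\ |\beta+(n-1)\alpha\rangle,$$ with $$\mathbf{u}|\beta+m\alpha\rangle=e^{i(\beta+m\alpha)}|\beta+m\alpha\rangle,\qquad m=0,\ldots,n-1,$$ and there exist complex constants $C_{\beta+m\alpha}\in\mathbb{C}$, $m=0,\ldots,n$, satisfying $$|C_{\beta+m\alpha}|^2=\sec(\tfrac12\alpha)\cos(\beta-\tfrac12\alpha+m\alpha)+R,\qquad m=0,\ldots,n,$$ and $C_{\beta+m\alpha}\neq0$ for $m=1,\ldots,n-1$, such that $$\mathbf{a}_-|\beta+m\alpha\rangle=C_{\beta+m\alpha}|\beta+(m-1)\alpha\rangle,\quad m=1,\ldots,n-1,$$ $$\mathbf{a}_+|\beta+m\alpha\rangle=\overline{C_{\beta+(m+1)\alpha}}\,|\beta+(m+1)\alpha\rangle,\quad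 m=0,\ldots,n-2.$$ Moreover, the action of $\mathbf{a}_-$ on the first basis vector and of $\mathbf{a}_+$ on the last one is given by one of the following two alternatives: either (i) $\mathbf{a}_-|\beta\rangle=0$ and $\mathbf{a}_+|\beta+(n-1)\alpha\rangle=0$, in which case $C_\beta=C_{\beta+n\alpha}=0$ (consistently with the formula for $|C_{\beta+m\alpha}|^2$); or (ii) $\mathbf{a}_-|\beta\rangle=C_\beta|\beta+(n-1)\alpha\rangle$ and $\mathbf{a}_+|\beta+(n-1)\alpha\rangle=\overline{C_\beta}\,|\beta\rangle$, in which case $C_\beta=C_{\beta+n\alpha}\neq0$ (satisfying the formula for $|C_{\beta+m\alpha}|^2$) and $n\alpha=2\pi k$ for some $k\in\mathbb{N}$ with $1\le k<n/2$ and $n,k$ relatively prime.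
   Context: For $R\in\mathbb{R}$, $\mathcal{A}(R)$ is the unital associative complex algebra generated by $\mathbf{x},\mathbf{y},\mathbf{z},\boldsymbol{\varepsilon},(1+\boldsymbol{\varepsilon}^2)^{-1}$, where $\boldsymbol{\varepsilon}$ is central and $(1+\boldsymbol{\varepsilon}^2)^{-1}$ is the inverse of $1+\boldsymbol{\varepsilon}^2$, subject to the relations $$[\mathbf{x},\mathbf{y}]=i\boldsymbol{\varepsilon}\mathbf{z},\quad[\mathbf{y},\mathbf{z}]=i\boldsymbol{\varepsilon}(\mathbf{w}\mathbf{x}+\mathbf{x}\mathbf{w}),\quad[\mathbf{z},\mathbf{x}]=i\boldsymbol{\varepsilon}(\mathbf{w}\mathbf{y}+\mathbf{y}\mathbf{w}),\quad\mathbf{z}^2+\mathbf{w}^2=1,$$ where $\mathbf{w}:=\mathbf{x}^2+\mathbf{y}^2-R$. It carries the conjugate-linear anti-multiplicative involution $\dagger$ with $\mathbf{x}^\dagger=\mathbf{x}$, $\mathbf{y}^\dagger=\mathbf{y}$, $\mathbf{z}^\dagger=\mathbf{z}$, $\boldsymbol{\varepsilon}^\dagger=\boldsymbol{\varepsilon}$ (so $\mathbf{w}^\dagger=\mathbf{w}$). Put $\mathbf{u}:=\mathbf{w}+i\mathbf{z}$ and $\mathbf{a}_\pm:=\mathbf{x}\pm i\mathbf{y}$. A representation $\Psi$ is adjoint preserving if $\Psi(\mathbf{f}^\dagger)=\Psi(\mathbf{f})^\dagger$ (Hermitian adjoint) for all $\mathbf{f}\in\mathcal{A}(R)$. For a vector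 $|\theta\rangle\in\mathcal{H}$ one writes $\mathbf{f}|\theta\rangle$ for $\Psi(\mathbf{f})|\theta\rangle$. "No multiple eigenvalues" means that all eigenspaces of $\Psi(\mathbf{u})$ are one-dimensional. *)

theory Defs
  imports
    "HOL-Analysis.Analysis"
    "HOL-Library.Poly_Mapping"
    "HOL-Algebra.QuotRing"
begin

section \<open>The free unital associative complex algebra on five generators\<close>

text \<open>\<open>GI\<close> is the generator that becomes the inverse of \<open>1 + \<epsilon>\<^sup>2\<close>.\<close>

datatype gen = GX | GY | GZ | GE | GI

datatype word = Word (letters: "gen list")

instantiation word :: monoid_add
begin

definition zero_word :: word
  where "0 = Word []"

definition plus_word :: "word \<Rightarrow> word \<Rightarrow> word"
  where "v + w = Word (letters v @ letters w)"

instance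
  by standard (simp_all add: zero_word_def plus_word_def)

end

text \<open>
  The product of \<^typ>\<open>word \<Rightarrow>\<^sub>0 complex\<close> is convolution over the monoid of words, so this type
  is the monoid algebra of the free monoid, i.e. the free algebra.
\<close>

type_synonym falg = "word \<Rightarrow>\<^sub>0 complex"

definition fgen :: "gen \<Rightarrow> falg"
  where "fgen g = Poly_Mapping.single (Word [g]) 1"

definition fconst :: "complex \<Rightarrow> falg"
  where "fconst c = Poly_Mapping.single 0 c"

lemma falg_induct [case_names single add]:
  fixes p :: falg
  assumes "\<And>w c. P (Poly_Mapping.single w c)"
    and "\<And>p q. P p \<Longrightarrow> P q \<Longrightarrow> P (p + q)"
  shows "P p"
proof (induction p rule: update_induct)
  case const
  show ?case
    using assms(1)[of 0 0] by simp
next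
  case (update f w c)
  then have "Poly_Mapping.update w c f = Poly_Mapping.single w c + f"
    by (intro poly_mapping_eqI)
      (auto simp: lookup_update lookup_add lookup_single when_def in_keys_iff)
  then show ?case
    using assms update by simp
qed

abbreviation "fx \<equiv> fgen GX"
abbreviation "fy \<equiv> fgen GY"
abbreviation "fz \<equiv> fgen GZ"
abbreviation "feps \<equiv> fgen GE"
abbreviation "finv \<equiv> fgen GI"

definition rev_word :: "word \<Rightarrow> word"
  where "rev_word w = Word (rev (letters w))"

lemma rev_word_rev_word [simp]: "rev_word (rev_word w) = w"
  by (simp add: rev_word_def)

lemma rev_word_add: "rev_word (v + w) = rev_word w + rev_word v"
  by (simp add: rev_word_def plus_word_def)

lemma rev_word_0 [simp]: "rev_word 0 = 0"
  by (simp add: rev_word_def zero_word_def)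

text \<open>The involution fixes every generator, reverses products and conjugates scalars.\<close>

lift_definition fstar :: "falg \<Rightarrow> falg"
  is "\<lambda>p w. cnj (p (rev_word w))"
proof -
  fix p :: "word \<Rightarrow> complex"
  assume "finite {w. p w \<noteq> 0}"
  then have "finite (rev_word ` {w. p w \<noteq> 0})"
    by simp
  moreover have "{w. cnj (p (rev_word w)) \<noteq> 0} \<subseteq> rev_word ` {w. p w \<noteq> 0}"
  proof
    fix w
    assume "w \<in> {w. cnj (p (rev_word w)) \<noteq> 0}"
    then have "rev_word w \<in> {w. p w \<noteq> 0}"
      by simp
    then have "rev_word (rev_word w) \<in> rev_word ` {w. p w \<noteq> 0}"
      by (rule imageI)
    then show "w \<in> rev_word ` {w. p w \<noteq> 0}"
      by simp
  qed
  ultimately show "finite {w. cnj (p (rev_word w)) \<noteq> 0}"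
    by (rule finite_subset[rotated])
qed

lemma fstar_fstar [simp]: "fstar (fstar p) = p"
  by transfer simp

lemma fstar_add: "fstar (p + q) = fstar p + fstar q"
  by transfer simp

lemma fstar_0 [simp]: "fstar 0 = 0"
  by transfer simp

lemma fstar_uminus: "fstar (- p) = - fstar p"
  using fstar_add[of p "- p"] by (simp add: eq_neg_iff_add_eq_0 add.commute)

lemma fstar_diff: "fstar (p - q) = fstar p - fstar q"
  using fstar_add[of p "- q"] by (simp add: fstar_uminus)

lemma fstar_single: "fstar (Poly_Mapping.single w c) = Poly_Mapping.single (rev_word w) (cnj c)"
  by transfer (auto simp: when_def fun_eq_iff)

lemma fstar_mult: "fstar (p * q) = fstar q * fstar p"
proof (induction p rule: falg_induct)
  case (single v c)
  show ?case
  proof (induction q rule: falg_induct)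
    case (single w d)
    show ?case
      by (simp add: mult_single fstar_single rev_word_add mult.commute)
  next
    case (add p q)
    then show ?case
      by (simp add: distrib_left distrib_right fstar_add)
  qed
next
  case (add p q)
  then show ?case
    by (simp add: distrib_left distrib_right fstar_add)
qed

lemma fstar_fconst [simp]: "fstar (fconst c) = fconst (cnj c)"
  by (simp add: fconst_def fstar_single)

lemma fstar_fgen [simp]: "fstar (fgen g) = fgen g"
  by (simp add: fgen_def fstar_single rev_word_def)

lemma fstar_1 [simp]: "fstar 1 = 1"
  using fstar_fconst[of 1] by (simp add: fconst_def)


section \<open>The algebra \<open>A(R)\<close>\<close>

definition falg_ring :: "falg ring"
  where "falg_ring = \<lparr>carrier = UNIV, mult = (*), one = 1, zero = 0, add = (+)\<rparr>"

definition fw :: "real \<Rightarrow> falg"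
  where "fw R = fx * fx + fy * fy - fconst (complex_of_real R)"

text \<open>Each relation \<open>l = r\<close> is represented by \<open>l - r\<close>.\<close>

definition relators :: "real \<Rightarrow> falg set"
  where "relators R =
    {fx * fy - fy * fx - fconst \<i> * feps * fz,
     fy * fz - fz * fy - fconst \<i> * feps * (fw R * fx + fx * fw R),
     fz * fx - fx * fz - fconst \<i> * feps * (fw R * fy + fy * fw R),
     fz * fz + fw R * fw R - 1,
     (1 + feps * feps) * finv - 1,
     finv * (1 + feps * feps) - 1}
    \<union> {feps * fgen g - fgen g * feps | g. True}"

text \<open>\<^const>\<open>genideal\<close> is the generated two-sided ideal.\<close>

definition rel_ideal :: "real \<Rightarrow> falg set"
  where "rel_ideal R = Idl\<^bsub>falg_ring\<^esub> (relators R)"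

definition alg :: "real \<Rightarrow> falg set ring"
  where "alg R = falg_ring Quot (rel_ideal R)"

definition cls :: "real \<Rightarrow> falg \<Rightarrow> falg set"
  where "cls R p = rel_ideal R +>\<^bsub>falg_ring\<^esub> p"

definition alg_scale :: "real \<Rightarrow> complex \<Rightarrow> falg set \<Rightarrow> falg set"
  where "alg_scale R c a = cls R (fconst c) \<otimes>\<^bsub>alg R\<^esub> a"

text \<open>
  The ideal of relations is invariant under \<^const>\<open>fstar\<close>, so the image of a residue class is
  a residue class; see \<open>alg_dagger_cls\<close> below.
\<close>

definition alg_dagger :: "falg set \<Rightarrow> falg set"
  where "alg_dagger a = fstar ` a"

definition alg_eps :: "real \<Rightarrow> falg set"
  where "alg_eps R = cls R feps"

definition alg_u :: "real \<Rightarrow> falg set"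
  where "alg_u R = cls R (fw R + fconst \<i> * fz)"

definition alg_a_plus :: "real \<Rightarrow> falg set"
  where "alg_a_plus R = cls R (fx + fconst \<i> * fy)"

definition alg_a_minus :: "real \<Rightarrow> falg set"
  where "alg_a_minus R = cls R (fx - fconst \<i> * fy)"

lemma ring_falg_ring: "ring falg_ring"
proof (intro ringI abelian_groupI monoidI)
  fix x
  assume "x \<in> carrier falg_ring"
  show "\<exists>y\<in>carrier falg_ring. y \<oplus>\<^bsub>falg_ring\<^esub> x = \<zero>\<^bsub>falg_ring\<^esub>"
    by (rule bexI[of _ "- x"]) (simp_all add: falg_ring_def)
qed (simp_all add: falg_ring_def algebra_simps)

lemma ideal_rel_ideal: "ideal (rel_ideal R) falg_ring"
  unfolding rel_ideal_def
  by (rule ring.genideal_ideal[OF ring_falg_ring]) (simp add: falg_ring_def)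

lemma cls_eq: "cls R p = {h + p | h. h \<in> rel_ideal R}"
  by (auto simp: cls_def a_r_coset_def' falg_ring_def)

lemma carrier_alg: "carrier (alg R) = range (cls R)"
  by (auto simp: alg_def FactRing_def A_RCOSETS_def' cls_def a_r_coset_def' falg_ring_def)

lemma ring_alg: "ring (alg R)"
  unfolding alg_def by (rule ideal.quotient_is_ring[OF ideal_rel_ideal])

lemma cls_ring_hom: "cls R \<in> ring_hom falg_ring (alg R)"
  using ideal.rcos_ring_hom[OF ideal_rel_ideal]
  by (simp add: alg_def cls_def[abs_def])

lemma alg_scale_cls: "alg_scale R c (cls R p) = cls R (fconst c * p)"
  using ring_hom_mult[OF cls_ring_hom, of "fconst c" p R]
  by (simp add: alg_scale_def falg_ring_def)

lemma rel_ideal_iff: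
  "p \<in> rel_ideal R \<longleftrightarrow> (\<forall>I. ideal I falg_ring \<and> relators R \<subseteq> I \<longrightarrow> p \<in> I)"
  by (auto simp: rel_ideal_def genideal_def)

lemma rel_ideal_closed:
  shows rel_ideal_add: "p \<in> rel_ideal R \<Longrightarrow> q \<in> rel_ideal R \<Longrightarrow> p + q \<in> rel_ideal R"
    and rel_ideal_0: "0 \<in> rel_ideal R"
    and rel_ideal_mult_left: "p \<in> rel_ideal R \<Longrightarrow> q * p \<in> rel_ideal R"
    and rel_ideal_mult_right: "p \<in> rel_ideal R \<Longrightarrow> p * q \<in> rel_ideal R"
    and rel_ideal_uminus: "p \<in> rel_ideal R \<Longrightarrow> - p \<in> rel_ideal R"
proof -
  interpret ideal "rel_ideal R" falg_ring
    by (rule ideal_rel_ideal)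
  show "p \<in> rel_ideal R \<Longrightarrow> q \<in> rel_ideal R \<Longrightarrow> p + q \<in> rel_ideal R"
    using additive_subgroup.a_closed[OF additive_subgroup_axioms, of p q] by (simp add: falg_ring_def)
  show "0 \<in> rel_ideal R"
    using additive_subgroup.zero_closed[OF additive_subgroup_axioms] by (simp add: falg_ring_def)
  show l: "p \<in> rel_ideal R \<Longrightarrow> q * p \<in> rel_ideal R" for p q
    using I_l_closed[of p q] by (simp add: falg_ring_def)
  show "p \<in> rel_ideal R \<Longrightarrow> p * q \<in> rel_ideal R"
    using I_r_closed[of p q] by (simp add: falg_ring_def)
  show "p \<in> rel_ideal R \<Longrightarrow> - p \<in> rel_ideal R"
    using l[of p "- 1"] by simp
qed

lemma relators_in_rel_ideal: "relators R \<subseteq> rel_ideal R"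
  by (auto simp: rel_ideal_iff)

lemma fconst_central: "fconst c * p = p * fconst c"
proof (induction p rule: falg_induct)
  case (single w d)
  show ?case
    by (simp add: fconst_def mult_single mult.commute)
next
  case (add p q)
  then show ?case
    by (simp add: distrib_left distrib_right)
qed

lemma fconst_uminus: "fconst (- c) = - fconst c"
  by (simp add: fconst_def single_uminus)

lemma fstar_fw [simp]: "fstar (fw R) = fw R"
  by (simp add: fw_def fstar_add fstar_diff fstar_mult)

lemma relators_fgen: "feps * fgen g - fgen g * feps \<in> rel_ideal R"
  using relators_in_rel_ideal[of R] by (auto simp: relators_def)

lemma feps_central_add:
  assumes "feps * p - p * feps \<in> rel_ideal R" "feps * q - q * feps \<in> rel_ideal R"
  shows "feps * (p + q) - (p + q) * feps \<in> rel_ideal R"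
  using rel_ideal_add[OF assms] by (simp add: algebra_simps)

lemma feps_central_mult:
  assumes "feps * p - p * feps \<in> rel_ideal R" "feps * q - q * feps \<in> rel_ideal R"
  shows "feps * (p * q) - (p * q) * feps \<in> rel_ideal R"
  using rel_ideal_add[OF rel_ideal_mult_right[OF assms(1), of q] rel_ideal_mult_left[OF assms(2), of p]]
  by (simp add: algebra_simps)

lemma feps_central_fw: "feps * fw R - fw R * feps \<in> rel_ideal R"
proof -
  have "feps * (fx * fx + fy * fy) - (fx * fx + fy * fy) * feps \<in> rel_ideal R"
    by (intro feps_central_add feps_central_mult relators_fgen)
  then show ?thesis
    by (simp add: fw_def algebra_simps fconst_central[of _ feps])
qed

lemma fstar_commutator_relator:
  assumes "p * q - q * p - fconst \<i> * feps * s \<in> rel_ideal R"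
    and "feps * s - s * feps \<in> rel_ideal R"
    and [simp]: "fstar p = p" "fstar q = q" "fstar s = s"
  shows "fstar (p * q - q * p - fconst \<i> * feps * s) \<in> rel_ideal R"
proof -
  have "fstar (p * q - q * p - fconst \<i> * feps * s) = q * p - p * q + s * feps * fconst \<i>"
    by (simp add: fstar_diff fstar_mult fconst_uminus mult.assoc)
  also have "\<dots> = q * p - p * q + fconst \<i> * (s * feps)"
    by (simp add: fconst_central)
  also have "\<dots> = - (p * q - q * p - fconst \<i> * feps * s) + - (fconst \<i> * (feps * s - s * feps))"
    by (simp add: algebra_simps)
  also have "\<dots> \<in> rel_ideal R"
    by (intro rel_ideal_add rel_ideal_uminus rel_ideal_mult_left assms(1,2))
  finally show ?thesis .
qed

lemma fstar_relators:
  assumes "p \<in> relators R"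
  shows "fstar p \<in> rel_ideal R"
proof -
  have mem: "q \<in> rel_ideal R" if "q \<in> relators R" for q
    using that relators_in_rel_ideal by blast
  have sym [simp]: "fstar (fw R * q + q * fw R) = fw R * q + q * fw R" if "fstar q = q" for q
    using that by (simp add: fstar_add fstar_mult add.commute)
  have central: "feps * (fw R * fgen g + fgen g * fw R) - (fw R * fgen g + fgen g * fw R) * feps
      \<in> rel_ideal R" for g
    by (intro feps_central_add feps_central_mult feps_central_fw relators_fgen)
  from assms consider
      "p = fx * fy - fy * fx - fconst \<i> * feps * fz"
    | "p = fy * fz - fz * fy - fconst \<i> * feps * (fw R * fx + fx * fw R)"
    | "p = fz * fx - fx * fz - fconst \<i> * feps * (fw R * fy + fy * fw R)"
    | "p = fz * fz + fw R * fw R - 1"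
    | "p = (1 + feps * feps) * finv - 1"
    | "p = finv * (1 + feps * feps) - 1"
    | g where "p = feps * fgen g - fgen g * feps"
    unfolding relators_def by blast
  then show ?thesis
  proof cases
    case 1
    show ?thesis
      unfolding 1 by (rule fstar_commutator_relator)
        (use mem[OF assms] 1 in \<open>simp_all add: relators_fgen\<close>)
  next
    case 2
    show ?thesis
      unfolding 2 by (rule fstar_commutator_relator[OF _ central])
        (use mem[OF assms] 2 in simp_all)
  next
    case 3
    show ?thesis
      unfolding 3 by (rule fstar_commutator_relator[OF _ central])
        (use mem[OF assms] 3 in simp_all)
  next
    case 4
    then have "fstar p = p"
      by (simp add: fstar_add fstar_diff fstar_mult)
    then show ?thesis
      using mem[OF assms] by simp
  next
    case 5
    then have "fstar p = finv * (1 + feps * feps) - 1"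
      by (simp add: fstar_add fstar_diff fstar_mult)
    then show ?thesis
      using mem[of "fstar p"] by (simp add: relators_def)
  next
    case 6
    then have "fstar p = (1 + feps * feps) * finv - 1"
      by (simp add: fstar_add fstar_diff fstar_mult)
    then show ?thesis
      using mem[of "fstar p"] by (simp add: relators_def)
  next
    case (7 g)
    then have "fstar p = - p"
      by (simp add: fstar_diff fstar_mult)
    then show ?thesis
      using rel_ideal_uminus[OF mem[OF assms]] by simp
  qed
qed

lemma ideal_falg_ringI:
  assumes "0 \<in> J"
    and "\<And>p q. p \<in> J \<Longrightarrow> q \<in> J \<Longrightarrow> p + q \<in> J"
    and "\<And>p q. p \<in> J \<Longrightarrow> q * p \<in> J"
    and "\<And>p q. p \<in> J \<Longrightarrow> p * q \<in> J"
  shows "ideal J falg_ring"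
proof (rule idealI[OF ring_falg_ring])
  interpret ring falg_ring
    by (rule ring_falg_ring)
  have "\<ominus>\<^bsub>falg_ring\<^esub> p \<in> J" if "p \<in> J" for p
  proof -
    have "\<ominus>\<^bsub>falg_ring\<^esub> p = - 1 * p"
      by (rule minus_equality) (simp_all add: falg_ring_def)
    then show ?thesis
      using assms(3)[OF that, of "- 1"] by simp
  qed
  then show "subgroup J (add_monoid falg_ring)"
    using assms(1,2)
    by (intro group.subgroupI[OF a_group])
      (auto simp: falg_ring_def a_inv_def)
qed (use assms in \<open>auto simp: falg_ring_def\<close>)

lemma fstar_rel_ideal: "fstar ` rel_ideal R = rel_ideal R"
proof -
  have "ideal {p. fstar p \<in> rel_ideal R} falg_ring"
    by (rule ideal_falg_ringI)
      (simp_all add: rel_ideal_0 fstar_add fstar_mult rel_ideal_add rel_ideal_mult_left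
        rel_ideal_mult_right)
  then have "p \<in> rel_ideal R \<Longrightarrow> fstar p \<in> rel_ideal R" for p
    unfolding rel_ideal_iff[of p] using fstar_relators by blast
  then show ?thesis
    by (metis fstar_fstar image_eqI image_subsetI subsetI subset_antisym)
qed

lemma alg_dagger_cls: "alg_dagger (cls R p) = cls R (fstar p)"
proof -
  have "alg_dagger (cls R p) = {fstar h + fstar p | h. h \<in> rel_ideal R}"
    unfolding alg_dagger_def cls_eq by (force simp: fstar_add image_iff)
  also have "\<dots> = {h + fstar p | h. h \<in> fstar ` rel_ideal R}"
    by blast
  also have "\<dots> = cls R (fstar p)"
    by (simp add: fstar_rel_ideal cls_eq)
  finally show ?thesis .
qed


section \<open>Complex inner product spaces\<close>

text \<open>
  The inner product is conjugate-linear in its first argument. Completeness is not an axiom: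
  it is automatic in finite dimension.
\<close>

class complex_inner = ab_group_add +
  fixes scaleC :: "complex \<Rightarrow> 'a \<Rightarrow> 'a" (infixr \<open>*\<^sub>C\<close> 75)
    and cinner :: "'a \<Rightarrow> 'a \<Rightarrow> complex"
  assumes scaleC_add_right: "c *\<^sub>C (v + w) = c *\<^sub>C v + c *\<^sub>C w"
    and scaleC_add_left: "(c + d) *\<^sub>C v = c *\<^sub>C v + d *\<^sub>C v"
    and scaleC_scaleC: "c *\<^sub>C d *\<^sub>C v = (c * d) *\<^sub>C v"
    and scaleC_one: "1 *\<^sub>C v = v"
    and cinner_commute: "cinner v w = cnj (cinner w v)"
    and cinner_add_right: "cinner v (w + w') = cinner v w + cinner v w'"
    and cinner_scaleC_right: "cinner v (c *\<^sub>C w) = c * cinner v w"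
    and cinner_pos: "v \<noteq> 0 \<Longrightarrow> 0 < Re (cinner v v)"

global_interpretation cvec: vector_space "scaleC :: complex \<Rightarrow> 'h \<Rightarrow> 'h::complex_inner"
  by standard (simp_all add: scaleC_add_right scaleC_add_left scaleC_scaleC scaleC_one)

text \<open>
  Finite dimensionality is required separately because \<^term>\<open>cvec.dim\<close> of an
  infinite-dimensional space is \<open>0\<close>.
\<close>

definition has_cdim :: "'h::complex_inner itself \<Rightarrow> nat \<Rightarrow> bool"
  where "has_cdim _ n \<longleftrightarrow>
    (\<exists>B::'h set. finite B \<and> cvec.span B = UNIV) \<and> cvec.dim (UNIV :: 'h set) = n"

definition orthonormal_basis :: "nat \<Rightarrow> (nat \<Rightarrow> 'h::complex_inner) \<Rightarrow> bool"
  where "orthonormal_basis n e \<longleftrightarrow>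
    (\<forall>j<n. \<forall>k<n. cinner (e j) (e k) = (if j = k then 1 else 0)) \<and>
    cvec.span (e ` {..<n}) = UNIV"

definition is_hermitian_adjoint :: "('h::complex_inner \<Rightarrow> 'h) \<Rightarrow> ('h \<Rightarrow> 'h) \<Rightarrow> bool"
  where "is_hermitian_adjoint S T \<longleftrightarrow> (\<forall>v w. cinner (S v) w = cinner v (T w))"

definition eigenspace :: "('h::complex_inner \<Rightarrow> 'h) \<Rightarrow> complex \<Rightarrow> 'h set"
  where "eigenspace T c = {v. T v = c *\<^sub>C v}"

text \<open>Every nonzero eigenspace is one-dimensional.\<close>

definition no_multiple_eigenvalues :: "('h::complex_inner \<Rightarrow> 'h) \<Rightarrow> bool"
  where "no_multiple_eigenvalues T \<longleftrightarrow>
    (\<forall>c. eigenspace T c \<noteq> {0} \<longrightarrow> cvec.dim (eigenspace T c) = 1)"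

definition end_ring :: "('h::complex_inner \<Rightarrow> 'h) ring"
  where "end_ring =
    \<lparr>carrier = {T. Vector_Spaces.linear scaleC scaleC T}, mult = (\<circ>), one = id,
     zero = (\<lambda>v. 0), add = (\<lambda>S T v. S v + T v)\<rparr>"


section \<open>Representations of \<open>A(R)\<close>\<close>

definition algebra_rep :: "real \<Rightarrow> (falg set \<Rightarrow> 'h::complex_inner \<Rightarrow> 'h) \<Rightarrow> bool"
  where "algebra_rep R \<Psi> \<longleftrightarrow>
    \<Psi> \<in> ring_hom (alg R) end_ring \<and>
    (\<forall>c. \<forall>a\<in>carrier (alg R). \<forall>v. \<Psi> (alg_scale R c a) v = c *\<^sub>C \<Psi> a v)"

text \<open>As usual, the zero representation does not count as irreducible.\<close>

definition irreducible_rep :: "real \<Rightarrow> (falg set \<Rightarrow> 'h::complex_inner \<Rightarrow> 'h) \<Rightarrow> bool"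
  where "irreducible_rep R \<Psi> \<longleftrightarrow>
    (UNIV :: 'h set) \<noteq> {0} \<and>
    (\<forall>S. cvec.subspace S \<and> (\<forall>a\<in>carrier (alg R). \<Psi> a ` S \<subseteq> S) \<longrightarrow> S = {0} \<or> S = UNIV)"

definition adjoint_preserving :: "real \<Rightarrow> (falg set \<Rightarrow> 'h::complex_inner \<Rightarrow> 'h) \<Rightarrow> bool"
  where "adjoint_preserving R \<Psi> \<longleftrightarrow>
    (\<forall>a\<in>carrier (alg R). is_hermitian_adjoint (\<Psi> (alg_dagger a)) (\<Psi> a))"

end

theory Submission
  imports Defs "HOL-Computational_Algebra.Fundamental_Theorem_Algebra"
begin

text \<open>
  The relations give \<open>A\<^sub>+ A\<^sub>- = W + R + \<epsilon> Z\<close>, \<open>A\<^sub>- A\<^sub>+ = W + R - \<epsilon> Z\<close> and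
  \<open>U A\<^sub>+ = e\<^sup>i\<^sup>\<alpha> A\<^sub>+ U\<close>. Hence \<open>U\<close> commutes with \<open>A\<^sub>+ A\<^sub>-\<close> and \<open>A\<^sub>- A\<^sub>+\<close>, so with \<open>W\<close> and \<open>Z\<close>, and
  is unitary. The operators \<open>A\<^sub>\<plusminus>\<close> shift the argument of an eigenvalue of \<open>U\<close> by \<open>\<plusminus>\<alpha>\<close>. Start with
  an eigenvector killed by \<open>A\<^sub>-\<close> if there is one, and with any eigenvector otherwise, and apply
  \<open>A\<^sub>+\<close> until the result is zero or the eigenvalue returns to the first one. In the second case
  finiteness of the spectrum forces the shift to be periodic, and then \<open>A\<^sub>+\<close> kills no eigenvector
  either. The span of the chain is invariant because the eigenspaces are lines, so it is everything.
\<close>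

section \<open>Complex inner product spaces\<close>

lemma cinner_add_left: "cinner (v + v') w = cinner v w + cinner v' (w :: 'h::complex_inner)"
  by (subst (1 2 3) cinner_commute) (simp add: cinner_add_right)

lemma cinner_scaleC_left: "cinner (c *\<^sub>C v) w = cnj c * cinner v (w :: 'h::complex_inner)"
  by (subst (1 2) cinner_commute) (simp add: cinner_scaleC_right)

lemma cinner_zero_right [simp]: "cinner v (0 :: 'h::complex_inner) = 0"
  using cinner_scaleC_right[of v 0 0] by simp

lemma cinner_zero_left [simp]: "cinner (0 :: 'h::complex_inner) v = 0"
  using cinner_commute[of 0 v] by simp

lemma cinner_minus_right [simp]: "cinner v (- w) = - cinner v (w :: 'h::complex_inner)"
  using cinner_add_right[of v w "- w"] by (simp add: eq_neg_iff_add_eq_0 add.commute)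

lemma cinner_diff_right: "cinner v (w - w') = cinner v w - cinner v (w' :: 'h::complex_inner)"
  using cinner_add_right[of v w "- w'"] by simp

lemma cinner_diff_left: "cinner (v - v') w = cinner v w - cinner v' (w :: 'h::complex_inner)"
  by (subst (1 2 3) cinner_commute) (simp add: cinner_diff_right)

definition cnorm :: "'h::complex_inner \<Rightarrow> real"
  where "cnorm v = sqrt (Re (cinner v v))"

lemma cnorm_pos_iff [simp]: "0 < cnorm v \<longleftrightarrow> v \<noteq> (0 :: 'h::complex_inner)"
  using cinner_pos[of v] by (auto simp: cnorm_def)

lemma cnorm_eq_0_iff [simp]: "cnorm v = 0 \<longleftrightarrow> v = (0 :: 'h::complex_inner)"
  using cnorm_pos_iff[of v] by (cases "v = 0") (simp_all add: cnorm_def)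

lemma cinner_self: "cinner v v = complex_of_real ((cnorm v)\<^sup>2)"
proof -
  have "0 \<le> Re (cinner v v)"
    using cinner_pos[of v] by (cases "v = 0") auto
  moreover have "Im (cinner v v) = 0"
    using cinner_commute[of v v] by (simp add: complex_eq_iff)
  ultimately show ?thesis
    by (simp add: cnorm_def complex_eq_iff)
qed

lemma cinner_normalized:
  fixes v :: "'h::complex_inner"
  assumes "v \<noteq> 0"
  shows "cinner (complex_of_real (1 / cnorm v) *\<^sub>C v) (complex_of_real (1 / cnorm v) *\<^sub>C v) = 1"
  unfolding cinner_scaleC_left cinner_scaleC_right
  using assms by (simp add: cinner_self power2_eq_square)

lemma cinner_self_eq_0 [simp]: "cinner v v = 0 \<longleftrightarrow> v = (0 :: 'h::complex_inner)"
  using cinner_pos[of v] by (cases "v = 0") auto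

section \<open>Orthonormal families and one-dimensional eigenspaces\<close>

lemma orthonormal_independent:
  fixes e :: "nat \<Rightarrow> 'h::complex_inner"
  assumes "\<And>j k. j < N \<Longrightarrow> k < N \<Longrightarrow> cinner (e j) (e k) = (if j = k then 1 else 0)"
  shows "inj_on e {..<N}" "cvec.independent (e ` {..<N})"
proof -
  show inj: "inj_on e {..<N}"
    by (rule inj_onI) (metis assms lessThan_iff zero_neq_one)
  show "cvec.independent (e ` {..<N})"
  proof (rule cvec.independent_if_scalars_zero)
    fix u x
    assume sum: "(\<Sum>x\<in>e ` {..<N}. u x *\<^sub>C x) = 0" and "x \<in> e ` {..<N}"
    then obtain j where j: "j < N" "x = e j"
      by blast
    have "cinner v (\<Sum>k\<in>K. g k) = (\<Sum>k\<in>K. cinner v (g k))" if "finite K" for v :: 'h and g and K :: "nat set"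
      using that by (induction K) (simp_all add: cinner_add_right)
    then have "0 = (\<Sum>k<N. u (e k) * cinner (e j) (e k))"
      using arg_cong[OF sum, of "cinner (e j)"] by (simp add: sum.reindex[OF inj] cinner_scaleC_right)
    also have "\<dots> = (\<Sum>k<N. if k = j then u (e k) else 0)"
      using j assms by (intro sum.cong) auto
    finally show "u x = 0"
      using j by (simp add: sum.delta)
  qed simp
qed

text \<open>The nonzero \<open>v\<close> makes the eigenspace nontrivial, hence contained in the
  span of a single \<open>b\<close>; the coefficient of \<open>v\<close> along \<open>b\<close> is
  nonzero and can be divided out.\<close>

lemma no_multiple_eigenvalues_proportional:
  fixes v w :: "'h::complex_inner"
  assumes "no_multiple_eigenvalues T" "T v = c *\<^sub>C v" "T w = c *\<^sub>C w" "v \<noteq> 0"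
  obtains t where "w = t *\<^sub>C v"
proof -
  have mem: "v \<in> eigenspace T c" "w \<in> eigenspace T c"
    using assms by (simp_all add: eigenspace_def)
  then have "cvec.dim (eigenspace T c) = 1"
    using assms(1,4) unfolding no_multiple_eigenvalues_def by blast
  then obtain B where B: "eigenspace T c \<subseteq> cvec.span B" "card B = 1"
    using cvec.basis_exists[of "eigenspace T c"] by metis
  then obtain b where "B = {b}"
    by (auto simp: card_1_singleton_iff)
  then obtain s s' where s: "v = s *\<^sub>C b" "w = s' *\<^sub>C b"
    using B mem unfolding \<open>B = {b}\<close> cvec.span_singleton by blast
  with assms(4) have "w = (s' / s) *\<^sub>C v"
    by auto
  then show ?thesis
    by (rule that)
qed


section \<open>Existence of eigenvectors\<close>

text \<open>This is p(T) v, computed by Horner's scheme directly on vectors, so that the operators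
  need not form a ring type.\<close>

definition poly_apply :: "('h::complex_inner \<Rightarrow> 'h) \<Rightarrow> complex poly \<Rightarrow> 'h \<Rightarrow> 'h"
  where "poly_apply T p v = fold_coeffs (\<lambda>a w. a *\<^sub>C v + T w) p 0"

context
  fixes T :: "'h::complex_inner \<Rightarrow> 'h"
  assumes lin: "Vector_Spaces.linear scaleC scaleC T"
begin

interpretation T: Vector_Spaces.linear scaleC scaleC T
  by (rule lin)

lemma poly_apply_0 [simp]: "poly_apply T 0 v = 0"
  by (simp add: poly_apply_def)

lemma poly_apply_pCons [simp]: "poly_apply T (pCons a p) v = a *\<^sub>C v + T (poly_apply T p v)"
  \<comment> \<open>\<open>pCons 0 0\<close> is \<open>0\<close>, whose coefficient list is empty,
    so this pair rests on \<open>T 0 = 0\<close> instead of one unfolding of the fold.\<close>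
  by (cases "a = 0 \<and> p = 0") (auto simp: poly_apply_def T.zero)

lemma poly_apply_add: "poly_apply T (p + q) v = poly_apply T p v + poly_apply T q v"
  by (induction p q rule: poly_induct2) (simp_all add: T.add algebra_simps)

lemma poly_apply_smult: "poly_apply T (smult c p) v = c *\<^sub>C poly_apply T p v"
  by (induction p) (simp_all add: T.scale algebra_simps)

lemma poly_apply_linear_factor:
  "poly_apply T ([:- c, 1:] * p) v = T (poly_apply T p v) - c *\<^sub>C poly_apply T p v"
proof -
  have "[:- c, 1:] * p = pCons 0 p + smult (- c) p"
    by simp
  then show ?thesis
    by (simp only: poly_apply_add poly_apply_smult poly_apply_pCons) simp
qed

lemma poly_apply_monom: "poly_apply T (monom 1 j) v = (T ^^ j) v"
  by (induction j) (simp_all add: monom_0 monom_Suc T.zero)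

text \<open>In finite dimension some iterate of \<open>v\<close> depends linearly on the earlier
  ones; the dependence is a monic polynomial that kills \<open>v\<close>.\<close>

lemma annihilating_poly_exists:
  fixes B :: "'h set"
  assumes fin: "finite B" "cvec.span B = UNIV"
  obtains p where "p \<noteq> 0" "poly_apply T p v = 0"
proof -
  have "\<exists>j. (T ^^ j) v \<in> cvec.span ((\<lambda>i. (T ^^ i) v) ` {..<j})"
  proof (rule ccontr)
    assume *: "\<not> ?thesis"
    \<comment> \<open>If every iterate were new, \<open>S m\<close> would be independent of size
      \<open>m\<close> for all \<open>m\<close>, against the bound \<open>card B\<close>.\<close>
    define S where "S m = (\<lambda>i. (T ^^ i) v) ` {..<m}" for m
    have "cvec.independent (S m) \<and> card (S m) = m" for m
    proof (induction m)
      case 0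
      show ?case
        by (simp add: S_def cvec.independent_empty)
    next
      case (Suc m)
      have "(T ^^ m) v \<notin> cvec.span (S m)"
        using * unfolding S_def by blast
      moreover from this have "(T ^^ m) v \<notin> S m"
        using cvec.span_base by blast
      moreover have "S (Suc m) = insert ((T ^^ m) v) (S m)" "finite (S m)"
        by (simp_all add: S_def lessThan_Suc)
      ultimately show ?case
        using Suc cvec.independent_insertI by (metis card_insert_disjoint)
    qed
    then have "Suc (card B) \<le> card B"
      using cvec.independent_span_bound[OF fin(1), of "S (Suc (card B))"] fin(2)
      by (metis subset_UNIV)
    then show False
      by simp
  qed
  then obtain j where j: "(T ^^ j) v \<in> cvec.span ((\<lambda>i. (T ^^ i) v) ` {..<j})"
    by blast
  \<comment> \<open>The values at \<open>v\<close> of polynomials of degree below \<open>j\<close>.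
    The condition on coefficients also covers \<open>j = 0\<close>, where only the zero polynomial
    is left.\<close>
  let ?V = "{poly_apply T r v | r. \<forall>k\<ge>j. coeff r k = 0}"
  have "cvec.subspace ?V"
  proof (rule cvec.subspaceI)
    show "0 \<in> ?V"
      by (rule CollectI, rule exI[of _ 0]) simp
  next
    fix x y
    assume "x \<in> ?V" "y \<in> ?V"
    then obtain r s where "x = poly_apply T r v" "y = poly_apply T s v"
      "\<forall>k\<ge>j. coeff r k = 0" "\<forall>k\<ge>j. coeff s k = 0"
      by blast
    then show "x + y \<in> ?V"
      by (intro CollectI exI[of _ "r + s"]) (simp add: poly_apply_add)
  next
    fix c x
    assume "x \<in> ?V"
    then obtain r where "x = poly_apply T r v" "\<forall>k\<ge>j. coeff r k = 0"
      by blast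
    then show "c *\<^sub>C x \<in> ?V"
      by (intro CollectI exI[of _ "smult c r"]) (simp add: poly_apply_smult)
  qed
  moreover have "(\<lambda>i. (T ^^ i) v) ` {..<j} \<subseteq> ?V"
  proof safe
    fix i
    assume "i < j"
    then show "\<exists>r. (T ^^ i) v = poly_apply T r v \<and> (\<forall>k\<ge>j. coeff r k = 0)"
      by (intro exI[of _ "monom 1 i"]) (simp add: poly_apply_monom)
  qed
  ultimately have "(T ^^ j) v \<in> ?V"
    using cvec.span_minimal j by blast
  then obtain r where r: "(T ^^ j) v = poly_apply T r v" "\<forall>k\<ge>j. coeff r k = 0"
    by blast
  have "coeff (monom 1 j + smult (- 1) r) j = 1"
    using r by simp
  then have "monom 1 j + smult (- 1) r \<noteq> 0"
    by (metis coeff_0 zero_neq_one)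
  moreover have "poly_apply T (monom 1 j + smult (- 1) r) v = 0"
    by (simp only: poly_apply_add poly_apply_smult poly_apply_monom r) simp
  ultimately show ?thesis
    by (rule that)
qed

text \<open>Split a root \<open>c\<close> off an annihilating polynomial of least degree. By
  minimality the cofactor \<open>q\<close> does not kill \<open>v\<close>, and its value at
  \<open>v\<close> is an eigenvector for \<open>c\<close>.\<close>

lemma eigenvector_exists:
  fixes B :: "'h set"
  assumes "finite B" "cvec.span B = UNIV" "(UNIV :: 'h set) \<noteq> {0}"
  obtains v c where "v \<noteq> 0" "T v = c *\<^sub>C v"
proof -
  obtain v :: 'h where v: "v \<noteq> 0"
    using assms(3) by blast
  define P where "P p \<longleftrightarrow> p \<noteq> 0 \<and> poly_apply T p v = 0" for p
  obtain p0 where "P p0"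
    using annihilating_poly_exists[OF assms(1,2)] unfolding P_def by metis
  then obtain p where p: "P p" and least: "\<And>q. P q \<Longrightarrow> degree p \<le> degree q"
    using ex_has_least_nat[of P p0 degree] by blast
  have "degree p \<noteq> 0"
  proof
    assume "degree p = 0"
    then obtain a where "p = [:a:]"
      by (rule degree_eq_zeroE)
    with p v show False
      by (simp add: P_def T.zero)
  qed
  then obtain c where "poly p c = 0"
    using fundamental_theorem_of_algebra[of p] by (auto simp: constant_degree)
  then obtain q where q: "p = [:- c, 1:] * q"
    by (auto simp: poly_eq_0_iff_dvd)
  with p have "q \<noteq> 0"
    by (auto simp: P_def)
  then have "degree p = Suc (degree q)"
    by (simp only: q) (subst degree_mult_eq, simp_all)
  with least[of q] \<open>q \<noteq> 0\<close> have "poly_apply T q v \<noteq> 0"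
    by (auto simp: P_def)
  moreover have "T (poly_apply T q v) = c *\<^sub>C poly_apply T q v"
    using p unfolding P_def q poly_apply_linear_factor by simp
  ultimately show ?thesis
    by (rule that)
qed

end



section \<open>Operators satisfying the relations\<close>

text \<open>The calculations need only the operator relations and hermiticity, so the quotient
  algebra is kept out; the central generator is replaced by the scalar by which it acts.\<close>

locale sphere_operators =
  fixes X Y Z W U Ap Am :: "'h::complex_inner \<Rightarrow> 'h" and R \<epsilon> \<alpha> :: real
  assumes linX: "Vector_Spaces.linear scaleC scaleC X"
    and linY: "Vector_Spaces.linear scaleC scaleC Y"
    and linZ: "Vector_Spaces.linear scaleC scaleC Z"
    and hermX: "cinner (X v) w = cinner v (X w)"
    and hermY: "cinner (Y v) w = cinner v (Y w)"
    and hermZ: "cinner (Z v) w = cinner v (Z w)"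
    and W_eq: "W v = X (X v) + Y (Y v) - complex_of_real R *\<^sub>C v"
    and comm_XY: "X (Y v) - Y (X v) = (\<i> * complex_of_real \<epsilon>) *\<^sub>C Z v"
    and comm_YZ: "Y (Z v) - Z (Y v) = (\<i> * complex_of_real \<epsilon>) *\<^sub>C (W (X v) + X (W v))"
    and comm_ZX: "Z (X v) - X (Z v) = (\<i> * complex_of_real \<epsilon>) *\<^sub>C (W (Y v) + Y (W v))"
    and ZZ_WW: "Z (Z v) + W (W v) = v"
    and U_eq: "U v = W v + \<i> *\<^sub>C Z v"
    and Ap_eq: "Ap v = X v + \<i> *\<^sub>C Y v"
    and Am_eq: "Am v = X v - \<i> *\<^sub>C Y v"
    and tan_alpha: "tan (\<alpha> / 2) = \<epsilon>" and alpha: "0 < \<alpha>" "\<alpha> < pi"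
begin

sublocale X: Vector_Spaces.linear scaleC scaleC X
  by (rule linX)

sublocale Y: Vector_Spaces.linear scaleC scaleC Y
  by (rule linY)

sublocale Z: Vector_Spaces.linear scaleC scaleC Z
  by (rule linZ)

lemma linear_Ap: "Vector_Spaces.linear scaleC scaleC Ap"
  by unfold_locales (simp_all add: Ap_eq X.add Y.add X.scale Y.scale algebra_simps)

lemma linear_Am: "Vector_Spaces.linear scaleC scaleC Am"
  by unfold_locales (simp_all add: Am_eq X.add Y.add X.scale Y.scale algebra_simps)

lemma linear_W: "Vector_Spaces.linear scaleC scaleC W"
  by unfold_locales (simp_all add: W_eq X.add Y.add X.scale Y.scale algebra_simps)

sublocale Ap: Vector_Spaces.linear scaleC scaleC Ap
  by (rule linear_Ap)

sublocale Am: Vector_Spaces.linear scaleC scaleC Am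
  by (rule linear_Am)

sublocale W: Vector_Spaces.linear scaleC scaleC W
  by (rule linear_W)

lemma linear_U: "Vector_Spaces.linear scaleC scaleC U"
  by unfold_locales (simp_all add: U_eq W.add Z.add W.scale Z.scale algebra_simps)

sublocale U: Vector_Spaces.linear scaleC scaleC U
  by (rule linear_U)

section \<open>Products and commutators of the ladder operators\<close>

lemma eps_pos: "0 < \<epsilon>"
  using tan_gt_zero[of "\<alpha> / 2"] alpha tan_alpha by simp

lemma Ap_Am: "Ap (Am v) = W v + complex_of_real R *\<^sub>C v + complex_of_real \<epsilon> *\<^sub>C Z v"
proof -
  have "Ap (Am v) = X (X v) + Y (Y v) - \<i> *\<^sub>C (X (Y v) - Y (X v))"
    by (simp add: Ap_eq Am_eq X.diff Y.diff X.scale Y.scale algebra_simps)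
  also have "\<dots> = X (X v) + Y (Y v) + complex_of_real \<epsilon> *\<^sub>C Z v"
    by (simp add: comm_XY)
  finally show ?thesis
    by (simp add: W_eq)
qed

lemma Am_Ap: "Am (Ap v) = W v + complex_of_real R *\<^sub>C v - complex_of_real \<epsilon> *\<^sub>C Z v"
proof -
  have "Am (Ap v) = X (X v) + Y (Y v) + \<i> *\<^sub>C (X (Y v) - Y (X v))"
    by (simp add: Ap_eq Am_eq X.add Y.add X.scale Y.scale algebra_simps)
  also have "\<dots> = X (X v) + Y (Y v) - complex_of_real \<epsilon> *\<^sub>C Z v"
    by (simp add: comm_XY)
  finally show ?thesis
    by (simp add: W_eq)
qed

text \<open>Of the two commutators with \<open>Z\<close>, one contributes the \<open>Y\<close> terms
  with factor \<open>\<i> * \<epsilon>\<close>, the other the \<open>X\<close> terms with factor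
  \<open>\<epsilon>\<close>; together they form \<open>Ap\<close>.\<close>

lemma comm_Z_Ap: "Z (Ap v) - Ap (Z v) = complex_of_real \<epsilon> *\<^sub>C (W (Ap v) + Ap (W v))"
proof -
  have "Z (Ap v) - Ap (Z v) = (Z (X v) - X (Z v)) - \<i> *\<^sub>C (Y (Z v) - Z (Y v))"
    by (simp add: Ap_eq Z.add Z.scale algebra_simps)
  then show ?thesis
    by (simp add: comm_ZX comm_YZ Ap_eq W.add W.scale algebra_simps)
qed

lemma comm_Z_Am: "Z (Am v) - Am (Z v) = - complex_of_real \<epsilon> *\<^sub>C (W (Am v) + Am (W v))"
proof -
  have "Z (Am v) - Am (Z v) = (Z (X v) - X (Z v)) + \<i> *\<^sub>C (Y (Z v) - Z (Y v))"
    by (simp add: Am_eq Z.diff Z.scale algebra_simps)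
  then show ?thesis
    by (simp add: comm_ZX comm_YZ Am_eq W.diff W.scale algebra_simps)
qed

text \<open>Obtained by evaluating \<open>A\<^sub>+ A\<^sub>- A\<^sub>+\<close> in two ways.\<close>

lemma comm_W_Ap: "W (Ap v) - Ap (W v) = - complex_of_real \<epsilon> *\<^sub>C (Z (Ap v) + Ap (Z v))"
proof -
  have "Ap (Am (Ap v)) = Ap (W v) + complex_of_real R *\<^sub>C Ap v - complex_of_real \<epsilon> *\<^sub>C Ap (Z v)"
    by (simp add: Am_Ap Ap.add Ap.diff Ap.scale)
  then show ?thesis
    unfolding Ap_Am[of "Ap v"] by (simp add: algebra_simps eq_diff_eq diff_eq_eq)
qed

lemma comm_W_Am: "W (Am v) - Am (W v) = complex_of_real \<epsilon> *\<^sub>C (Z (Am v) + Am (Z v))"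
proof -
  have "Am (Ap (Am v)) = Am (W v) + complex_of_real R *\<^sub>C Am v + complex_of_real \<epsilon> *\<^sub>C Am (Z v)"
    by (simp add: Ap_Am Am.add Am.diff Am.scale)
  then show ?thesis
    unfolding Am_Ap[of "Am v"] by (simp add: algebra_simps eq_diff_eq diff_eq_eq)
qed

text \<open>Since \<open>\<epsilon>\<close> is the tangent of the half angle,
  \<open>1 + \<i> * \<epsilon>\<close> and \<open>1 - \<i> * \<epsilon>\<close> are
  \<open>cis (\<alpha> / 2)\<close> and its conjugate, both divided by
  \<open>cos (\<alpha> / 2)\<close>.\<close>

lemma cis_alpha: "(1 - \<i> * complex_of_real \<epsilon>) * cis \<alpha> = 1 + \<i> * complex_of_real \<epsilon>"
proof -
  have pos: "cos (\<alpha> / 2) \<noteq> 0"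
    using cos_gt_zero_pi[of "\<alpha> / 2"] alpha by simp
  then have s: "sin (\<alpha> / 2) = \<epsilon> * cos (\<alpha> / 2)"
    using tan_alpha by (auto simp: tan_def field_simps)
  have "cis (\<alpha> / 2) = complex_of_real (cos (\<alpha> / 2)) * (1 + \<i> * complex_of_real \<epsilon>)"
    by (simp add: complex_eq_iff s)
  moreover have "cis (- (\<alpha> / 2)) = complex_of_real (cos (\<alpha> / 2)) * (1 - \<i> * complex_of_real \<epsilon>)"
    by (simp add: complex_eq_iff s)
  moreover have "cis (- (\<alpha> / 2)) * cis \<alpha> = cis (\<alpha> / 2)"
    by (simp add: cis_mult)
  ultimately show ?thesis
    using pos by (simp add: mult.assoc)
qed

lemma one_minus_i_eps [simp]: "1 - \<i> * complex_of_real \<epsilon> \<noteq> 0"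
  by (simp add: complex_eq_iff)

text \<open>Adding \<open>\<i>\<close> times the commutator of \<open>Z\<close> to that of
  \<open>W\<close> turns the right-hand side into a multiple of \<open>U Ap + Ap U\<close>;
  collecting terms leaves the two factors of \<open>cis_alpha\<close>.\<close>

lemma U_Ap: "U (Ap v) = cis \<alpha> *\<^sub>C Ap (U v)"
proof -
  have "(1 - \<i> * complex_of_real \<epsilon>) *\<^sub>C U (Ap v) - (1 + \<i> * complex_of_real \<epsilon>) *\<^sub>C Ap (U v) =
      (W (Ap v) - Ap (W v) + complex_of_real \<epsilon> *\<^sub>C (Z (Ap v) + Ap (Z v))) +
      \<i> *\<^sub>C (Z (Ap v) - Ap (Z v) - complex_of_real \<epsilon> *\<^sub>C (W (Ap v) + Ap (W v)))"
    by (simp add: U_eq Ap.add Ap.scale algebra_simps)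
  also have "\<dots> = 0"
    by (simp add: comm_Z_Ap comm_W_Ap)
  finally have "(1 - \<i> * complex_of_real \<epsilon>) *\<^sub>C U (Ap v) =
      (1 - \<i> * complex_of_real \<epsilon>) *\<^sub>C cis \<alpha> *\<^sub>C Ap (U v)"
    by (simp add: cis_alpha)
  then show ?thesis
    by (rule cvec.scale_left_imp_eq[OF one_minus_i_eps])
qed

lemma Am_U: "cis \<alpha> *\<^sub>C U (Am v) = Am (U v)"
proof -
  have "(1 + \<i> * complex_of_real \<epsilon>) *\<^sub>C U (Am v) - (1 - \<i> * complex_of_real \<epsilon>) *\<^sub>C Am (U v) =
      (W (Am v) - Am (W v) - complex_of_real \<epsilon> *\<^sub>C (Z (Am v) + Am (Z v))) +
      \<i> *\<^sub>C (Z (Am v) - Am (Z v) + complex_of_real \<epsilon> *\<^sub>C (W (Am v) + Am (W v)))"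
    by (simp add: U_eq Am.add Am.scale algebra_simps)
  also have "\<dots> = 0"
    by (simp add: comm_Z_Am comm_W_Am)
  finally have "(1 - \<i> * complex_of_real \<epsilon>) *\<^sub>C cis \<alpha> *\<^sub>C U (Am v) =
      (1 - \<i> * complex_of_real \<epsilon>) *\<^sub>C Am (U v)"
    by (simp add: cis_alpha)
  then show ?thesis
    by (rule cvec.scale_left_imp_eq[OF one_minus_i_eps])
qed

section \<open>Adjoints and unitarity of \<open>U\<close>\<close>

lemma cinner_Ap: "cinner (Ap v) w = cinner v (Am w)"
  by (simp add: Ap_eq Am_eq cinner_add_left cinner_diff_right cinner_scaleC_left
      cinner_scaleC_right hermX hermY)

lemma cinner_Am: "cinner (Am v) w = cinner v (Ap w)"
  by (simp add: Ap_eq Am_eq cinner_diff_left cinner_add_right cinner_scaleC_left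
      cinner_scaleC_right hermX hermY)

lemma cinner_W: "cinner (W v) w = cinner v (W w)"
  by (simp add: W_eq cinner_diff_left cinner_diff_right cinner_add_left cinner_add_right
      cinner_scaleC_left cinner_scaleC_right hermX hermY)

text \<open>The phases cancel when \<open>U\<close> passes both ladder operators, so
  \<open>U\<close> commutes with \<open>Ap Am\<close> and \<open>Am Ap\<close>, hence with their
  difference, the nonzero multiple \<open>2 * \<epsilon>\<close> of \<open>Z\<close>.\<close>

lemma W_Z: "W (Z v) = Z (W v)"
proof -
  have "cis \<alpha> *\<^sub>C U (Am (Ap v)) = cis \<alpha> *\<^sub>C Am (Ap (U v))"
    by (simp add: Am_U U_Ap Am.scale)
  then have am: "U (Am (Ap v)) = Am (Ap (U v))"
    by (simp add: cis_neq_zero)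
  have ap: "U (Ap (Am v)) = Ap (Am (U v))"
    by (simp only: U_Ap flip: Ap.scale) (simp only: Am_U)
  have comm: "Ap (Am x) - Am (Ap x) = (2 * complex_of_real \<epsilon>) *\<^sub>C Z x" for x
    by (simp only: Ap_Am Am_Ap mult_2 cvec.scale_left_distrib) simp
  have "(2 * complex_of_real \<epsilon>) *\<^sub>C U (Z v) = U (Ap (Am v) - Am (Ap v))"
    by (simp only: comm U.scale)
  also have "\<dots> = Ap (Am (U v)) - Am (Ap (U v))"
    by (simp only: U.diff am ap)
  also have "\<dots> = (2 * complex_of_real \<epsilon>) *\<^sub>C Z (U v)"
    by (rule comm)
  finally have "(2 * complex_of_real \<epsilon>) *\<^sub>C U (Z v) = (2 * complex_of_real \<epsilon>) *\<^sub>C Z (U v)" .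
  then have "U (Z v) = Z (U v)"
    using eps_pos by simp
  then show ?thesis
    by (simp add: U_eq Z.add Z.scale)
qed

text \<open>\<open>W - \<i> Z\<close> is the adjoint of \<open>U\<close>. The cross terms of the
  product cancel by \<open>W_Z\<close>, and the squares add up to the identity.\<close>

lemma U_star_U: "W (U v) - \<i> *\<^sub>C Z (U v) = v"
proof -
  have "W (U v) - \<i> *\<^sub>C Z (U v) = Z (Z v) + W (W v)"
    by (simp add: U_eq W.add Z.add W.scale Z.scale W_Z algebra_simps)
  then show ?thesis
    by (simp add: ZZ_WW)
qed

lemma cinner_U: "cinner (U v) (U w) = cinner v w"
proof -
  have "cinner (U v) w' = cinner v (W w' - \<i> *\<^sub>C Z w')" for w'
    by (simp add: U_eq cinner_add_left cinner_diff_right cinner_scaleC_left cinner_scaleC_right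
        cinner_W hermZ)
  then show ?thesis
    by (simp add: U_star_U)
qed

lemma eigenvalue_cmod:
  assumes "v \<noteq> 0" "U v = c *\<^sub>C v"
  shows "cmod c = 1"
proof -
  have "cnj c * c * cinner v v = cinner (U v) (U v)"
    by (simp only: assms(2) cinner_scaleC_left cinner_scaleC_right mult.assoc mult.left_commute)
  also have "\<dots> = 1 * cinner v v"
    by (simp only: cinner_U mult_1)
  finally have "cnj c * c * cinner v v = 1 * cinner v v" .
  then have "cnj c * c = 1"
    using assms(1) mult_right_cancel[of "cinner v v"] cinner_self_eq_0 by blast
  then have "c * cnj c = 1"
    by (simp only: mult.commute)
  then have "complex_of_real ((cmod c)\<^sup>2) = 1"
    by (simp only: complex_norm_square)
  then have "(cmod c)\<^sup>2 = 1"
    by (simp only: of_real_eq_1_iff)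
  then show ?thesis
    by (simp add: power2_eq_1_iff) (use norm_ge_zero[of c] in linarith)
qed

lemma eigenvalue_cis:
  assumes "v \<noteq> 0" "U v = c *\<^sub>C v"
  obtains \<beta> where "c = cis \<beta>"
proof
  have "c \<noteq> 0" "cmod c = 1"
    using eigenvalue_cmod[OF assms] by auto
  then show "c = cis (Arg c)"
    by (simp add: cis_Arg sgn_div_norm)
qed

text \<open>By \<open>U_star_U\<close> the adjoint of \<open>U\<close> multiplies \<open>v\<close>
  by \<open>cis (- \<theta>)\<close>; \<open>W\<close> and \<open>Z\<close> are the real and
  imaginary parts of \<open>U\<close>.\<close>

lemma W_Z_eigenvector:
  assumes "U v = cis \<theta> *\<^sub>C v"
  shows "W v = complex_of_real (cos \<theta>) *\<^sub>C v" "Z v = complex_of_real (sin \<theta>) *\<^sub>C v"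
proof -
  have "v = cis \<theta> *\<^sub>C (W v - \<i> *\<^sub>C Z v)"
    using U_star_U[of v] by (simp add: assms W.scale Z.scale algebra_simps)
  then have "cis (- \<theta>) *\<^sub>C v = (cis (- \<theta>) * cis \<theta>) *\<^sub>C (W v - \<i> *\<^sub>C Z v)"
    by (metis cvec.scale_scale)
  then have *: "W v - \<i> *\<^sub>C Z v = cis (- \<theta>) *\<^sub>C v"
    by (simp add: cis_mult)
  have "2 *\<^sub>C W v = (W v + \<i> *\<^sub>C Z v) + (W v - \<i> *\<^sub>C Z v)"
    using cvec.scale_left_distrib[of 1 1 "W v"] by simp
  also have "\<dots> = (cis \<theta> + cis (- \<theta>)) *\<^sub>C v"
    unfolding * U_eq[symmetric] assms by (simp add: cvec.scale_left_distrib)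
  also have "cis \<theta> + cis (- \<theta>) = 2 * complex_of_real (cos \<theta>)"
    by (simp add: complex_eq_iff)
  finally have "2 *\<^sub>C W v = 2 *\<^sub>C complex_of_real (cos \<theta>) *\<^sub>C v"
    by simp
  then show "W v = complex_of_real (cos \<theta>) *\<^sub>C v"
    by (rule cvec.scale_left_imp_eq[rotated]) simp
  have "(2 * \<i>) *\<^sub>C Z v = (W v + \<i> *\<^sub>C Z v) - (W v - \<i> *\<^sub>C Z v)"
    using cvec.scale_left_distrib[of \<i> \<i> "Z v"] by simp
  also have "\<dots> = (cis \<theta> - cis (- \<theta>)) *\<^sub>C v"
    unfolding * U_eq[symmetric] assms by (simp add: cvec.scale_left_diff_distrib)
  also have "cis \<theta> - cis (- \<theta>) = 2 * \<i> * complex_of_real (sin \<theta>)"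
    by (simp add: complex_eq_iff)
  finally have "(2 * \<i>) *\<^sub>C Z v = (2 * \<i>) *\<^sub>C complex_of_real (sin \<theta>) *\<^sub>C v"
    by simp
  then show "Z v = complex_of_real (sin \<theta>) *\<^sub>C v"
    by (rule cvec.scale_left_imp_eq[rotated]) simp
qed

lemma eigenvectors_orthogonal:
  assumes "U v = cis \<theta> *\<^sub>C v" "U w = cis \<phi> *\<^sub>C w" "cis \<theta> \<noteq> cis \<phi>"
  shows "cinner v w = 0"
proof (rule ccontr)
  assume "cinner v w \<noteq> 0"
  moreover have "cis (- \<theta>) * cis \<phi> * cinner v w = cinner (U v) (U w)"
    by (simp only: assms cinner_scaleC_left cinner_scaleC_right cis_cnj mult.assoc mult.left_commute)
  then have "cis (- \<theta>) * cis \<phi> * cinner v w = 1 * cinner v w"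
    by (simp only: cinner_U mult_1)
  ultimately have "cis (- \<theta>) * cis \<phi> = 1"
    using mult_right_cancel[of "cinner v w"] by blast
  then have "cis (\<phi> - \<theta>) = 1"
    by (simp add: cis_mult)
  then have "cis (\<phi> - \<theta>) * cis \<theta> = cis \<theta>"
    by simp
  with assms(3) show False
    by (simp add: cis_mult)
qed

text \<open>The squared modulus prescribed for the constant at argument \<open>\<theta>\<close>, and
  the eigenvalue there of \<open>Ap Am\<close>.\<close>

definition C_sqr :: "real \<Rightarrow> real"
  where "C_sqr \<theta> = 1 / cos (\<alpha> / 2) * cos (\<theta> - \<alpha> / 2) + R"

text \<open>Expanding the cosine and dividing by \<open>cos (\<alpha> / 2)\<close> produces the
  tangent \<open>\<epsilon>\<close>. The two forms match \<open>Ap_Am\<close> and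
  \<open>Am_Ap\<close> on an eigenvector.\<close>

lemma C_sqr_alt:
  "C_sqr \<theta> = cos \<theta> + R + \<epsilon> * sin \<theta>" "C_sqr (\<theta> + \<alpha>) = cos \<theta> + R - \<epsilon> * sin \<theta>"
proof -
  have pos: "cos (\<alpha> / 2) \<noteq> 0"
    using cos_gt_zero_pi[of "\<alpha> / 2"] alpha by simp
  have eps: "\<epsilon> = sin (\<alpha> / 2) / cos (\<alpha> / 2)"
    using tan_alpha by (simp add: tan_def)
  show "C_sqr \<theta> = cos \<theta> + R + \<epsilon> * sin \<theta>"
    unfolding C_sqr_def eps cos_diff using pos by (simp add: field_simps)
  have "\<theta> + \<alpha> - \<alpha> / 2 = \<theta> + \<alpha> / 2"
    by simp
  then have "C_sqr (\<theta> + \<alpha>) = 1 / cos (\<alpha> / 2) * cos (\<theta> + \<alpha> / 2) + R"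
    by (simp only: C_sqr_def)
  then show "C_sqr (\<theta> + \<alpha>) = cos \<theta> + R - \<epsilon> * sin \<theta>"
    unfolding eps cos_add using pos by (simp add: field_simps)
qed

section \<open>Ladder operators on an eigenvector of \<open>U\<close>\<close>

lemma Ap_Am_eigenvector:
  assumes "U v = cis \<theta> *\<^sub>C v"
  shows "Ap (Am v) = complex_of_real (C_sqr \<theta>) *\<^sub>C v"
  by (simp add: Ap_Am C_sqr_alt(1) W_Z_eigenvector[OF assms] cvec.scale_left_distrib)

lemma Am_Ap_eigenvector:
  assumes "U v = cis \<theta> *\<^sub>C v"
  shows "Am (Ap v) = complex_of_real (C_sqr (\<theta> + \<alpha>)) *\<^sub>C v"
  by (simp add: Am_Ap C_sqr_alt(2) W_Z_eigenvector[OF assms] cvec.scale_left_distrib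
      cvec.scale_left_diff_distrib)

lemma cinner_Am_Am:
  assumes "U v = cis \<theta> *\<^sub>C v"
  shows "cinner (Am v) (Am v) = complex_of_real (C_sqr \<theta>) * cinner v v"
  by (simp add: cinner_Am Ap_Am_eigenvector[OF assms] cinner_scaleC_right)

lemma cinner_Ap_Ap:
  assumes "U v = cis \<theta> *\<^sub>C v"
  shows "cinner (Ap v) (Ap v) = complex_of_real (C_sqr (\<theta> + \<alpha>)) * cinner v v"
  by (simp add: cinner_Ap Am_Ap_eigenvector[OF assms] cinner_scaleC_right)

lemma U_Ap_eigenvector:
  assumes "U v = cis \<theta> *\<^sub>C v"
  shows "U (Ap v) = cis (\<theta> + \<alpha>) *\<^sub>C Ap v"
  by (simp add: U_Ap assms Ap.scale cis_mult add.commute)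

lemma U_Am_eigenvector:
  assumes "U v = cis \<theta> *\<^sub>C v"
  shows "U (Am v) = cis (\<theta> - \<alpha>) *\<^sub>C Am v"
proof -
  have "cis (- \<alpha>) *\<^sub>C cis \<alpha> *\<^sub>C U (Am v) = cis (- \<alpha>) *\<^sub>C cis \<theta> *\<^sub>C Am v"
    by (simp only: Am_U assms Am.scale)
  then show ?thesis
    by (simp add: cis_mult)
qed

lemma U_Ap_funpow:
  assumes "U v = cis \<theta> *\<^sub>C v"
  shows "U ((Ap ^^ m) v) = cis (\<theta> + real m * \<alpha>) *\<^sub>C (Ap ^^ m) v"
proof (induction m)
  case (Suc m)
  show ?case
    using U_Ap_eigenvector[OF Suc] by (simp add: algebra_simps)
qed (simp add: assms)

lemma U_Am_funpow:
  assumes "U v = cis \<theta> *\<^sub>C v"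
  shows "U ((Am ^^ m) v) = cis (\<theta> - real m * \<alpha>) *\<^sub>C (Am ^^ m) v"
proof (induction m)
  case (Suc m)
  show ?case
    using U_Am_eigenvector[OF Suc] by (simp add: algebra_simps)
qed (simp add: assms)

lemma cis_add_eq_iff: "cis (\<beta> + a) = cis (\<beta> + b) \<longleftrightarrow> cis (a - b) = 1"
proof -
  have "cis (\<beta> + a) = cis (a - b) * cis (\<beta> + b)"
    by (simp add: cis_mult algebra_simps)
  then show ?thesis
    by (simp add: cis_neq_zero)
qed

end


section \<open>The ladder of eigenvectors\<close>

text \<open>Invariance is asked for \<open>X\<close> and \<open>Y\<close> alone, because the other
  generators act through these two or as scalars.\<close>

locale irreducible_sphere_operators = sphere_operators X Y Z W U Ap Am R \<epsilon> \<alpha>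
  for X Y Z W U Ap Am :: "'h::complex_inner \<Rightarrow> 'h" and R \<epsilon> \<alpha> :: real +
  fixes n :: nat and B :: "'h set"
  assumes fin: "finite B" "cvec.span B = UNIV" and dim: "cvec.dim (UNIV :: 'h set) = n"
    and nontrivial: "(UNIV :: 'h set) \<noteq> {0}"
    and irreducible: "\<lbrakk>cvec.subspace S; X ` S \<subseteq> S; Y ` S \<subseteq> S\<rbrakk> \<Longrightarrow> S = {0} \<or> S = UNIV"
    and mult_free: "no_multiple_eigenvalues U"
begin

text \<open>Eigenvectors of distinct eigenvalues are orthogonal, so a sequence without repetition
  would give more than \<open>card B\<close> orthonormal vectors.\<close>

lemma repeated_eigenvalue:
  assumes "\<And>i. v i \<noteq> 0" "\<And>i. U (v i) = cis (\<theta> i) *\<^sub>C v i"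
  obtains i j :: nat where "i < j" "cis (\<theta> i) = cis (\<theta> j)"
proof (rule ccontr)
  assume "\<not> thesis"
  with that have "\<not> (i < j \<and> cis (\<theta> i) = cis (\<theta> j))" for i j
    by blast
  then have distinct: "cis (\<theta> i) \<noteq> cis (\<theta> j)" if "i \<noteq> j" for i j
    using that by (metis nat_neq_iff)
  define e where "e i = complex_of_real (1 / cnorm (v i)) *\<^sub>C v i" for i
  have "cinner (e i) (e j) = (if i = j then 1 else 0)" for i j
    using assms(1) eigenvectors_orthogonal[OF assms(2) assms(2) distinct]
    by (auto simp: e_def cinner_scaleC_left cinner_scaleC_right cinner_self power2_eq_square)
  then have "inj_on e {..<Suc (card B)}" "cvec.independent (e ` {..<Suc (card B)})"
    by (intro orthonormal_independent; simp)+
  then show False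
    using cvec.independent_span_bound[OF fin(1), of "e ` {..<Suc (card B)}"] fin(2)
    by (simp add: card_image)
qed

lemma proportional:
  assumes "U v = cis \<theta> *\<^sub>C v" "U w = cis \<phi> *\<^sub>C w" "cis \<theta> = cis \<phi>" "v \<noteq> 0"
  obtains t where "w = t *\<^sub>C v"
  using assms no_multiple_eigenvalues_proportional[OF mult_free, of v "cis \<theta>" w] by metis

text \<open>Both alternatives of the theorem in one form: the chain always closes up, with constant
  \<open>C 0\<close> that vanishes exactly in the first alternative. The length \<open>N\<close>
  stays free until it is shown to be the dimension.\<close>

definition ladder_basis :: "real \<Rightarrow> nat \<Rightarrow> (nat \<Rightarrow> 'h) \<Rightarrow> (nat \<Rightarrow> complex) \<Rightarrow> bool"
  where "ladder_basis \<beta> N e C \<longleftrightarrow>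
    orthonormal_basis N e \<and>
    (\<forall>m<N. U (e m) = cis (\<beta> + real m * \<alpha>) *\<^sub>C e m) \<and>
    (\<forall>m\<le>N. (cmod (C m))\<^sup>2 = C_sqr (\<beta> + real m * \<alpha>)) \<and>
    (\<forall>m. 1 \<le> m \<and> m < N \<longrightarrow> C m \<noteq> 0) \<and>
    (\<forall>m. 1 \<le> m \<and> m < N \<longrightarrow> Am (e m) = C m *\<^sub>C e (m - 1)) \<and>
    (\<forall>m. m + 1 < N \<longrightarrow> Ap (e m) = cnj (C (m + 1)) *\<^sub>C e (m + 1)) \<and>
    Am (e 0) = C 0 *\<^sub>C e (N - 1) \<and> Ap (e (N - 1)) = cnj (C 0) *\<^sub>C e 0 \<and> C 0 = C N"

text \<open>\<open>X\<close> and \<open>Y\<close> are linear combinations of \<open>Ap\<close> and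
  \<open>Am\<close>, so the span is a nonzero invariant subspace and irreducibility applies.\<close>

lemma invariant_span_eq_UNIV:
  assumes "\<And>m. m < N \<Longrightarrow> Ap (e m) \<in> cvec.span (e ` {..<N})"
    and "\<And>m. m < N \<Longrightarrow> Am (e m) \<in> cvec.span (e ` {..<N})"
    and "m < N" "e m \<noteq> 0"
  shows "cvec.span (e ` {..<N}) = UNIV"
proof -
  let ?S = "cvec.span (e ` {..<N})"
  have "cvec.span (Ap ` e ` {..<N}) \<subseteq> ?S" "cvec.span (Am ` e ` {..<N}) \<subseteq> ?S"
    by (rule cvec.span_minimal; use assms(1,2) in auto)+
  then have Ap: "Ap v \<in> ?S" and Am: "Am v \<in> ?S" if "v \<in> ?S" for v
    using that unfolding Ap.span_image Am.span_image by blast+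
  have "X v = (1 / 2) *\<^sub>C (Ap v + Am v)" for v
    by (simp add: Ap_eq Am_eq flip: cvec.scale_left_distrib cvec.scale_right_distrib)
      (simp add: cvec.scale_right_distrib flip: cvec.scale_left_distrib)
  then have X: "X v \<in> ?S" if "v \<in> ?S" for v
    using Ap[OF that] Am[OF that] by (simp add: cvec.span_add cvec.span_scale)
  have "Y v = (- \<i> / 2) *\<^sub>C (Ap v - Am v)" for v
    by (simp add: Ap_eq Am_eq cvec.scale_right_distrib flip: cvec.scale_left_distrib)
  then have Y: "Y v \<in> ?S" if "v \<in> ?S" for v
    using Ap[OF that] Am[OF that] by (simp add: cvec.span_diff cvec.span_scale cvec.span_neg)
  have "?S \<noteq> {0}"
    using assms(3,4) cvec.span_base[of "e m" "e ` {..<N}"] by auto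
  then show ?thesis
    using irreducible[of ?S] X Y by blast
qed

text \<open>Serves both kinds of chain: it stops at both ends for \<open>t = t' = 0\<close> and
  closes up for nonzero scalars. The normalized iterates are orthonormal because their eigenvalues
  differ.\<close>

lemma ladder:
  assumes v: "v \<noteq> 0" "U v = cis \<beta> *\<^sub>C v" and N: "1 \<le> N"
    and nonzero: "\<And>m. m < N \<Longrightarrow> (Ap ^^ m) v \<noteq> 0"
    and aperiodic: "\<And>j. 0 < j \<Longrightarrow> j < N \<Longrightarrow> cis (real j * \<alpha>) \<noteq> 1"
    and top: "(Ap ^^ N) v = t *\<^sub>C v" and bottom: "Am v = t' *\<^sub>C (Ap ^^ (N - 1)) v"
  obtains e C where "ladder_basis \<beta> N e C" "N = n"
proof -
  define f where "f m = (Ap ^^ m) v" for m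
  define e where "e m = complex_of_real (1 / cnorm (f m)) *\<^sub>C f m" for m
  \<comment> \<open>The growth factor of \<open>Ap\<close> from one iterate to the next, meaningful
    for \<open>1 \<le> m\<close> and \<open>m < N\<close>.\<close>
  define r where "r m = cnorm (f m) / cnorm (f (m - 1))" for m
  have norm_pos: "0 < cnorm (f m)" if "m < N" for m
    using nonzero[OF that] by (simp add: f_def)
  have f_e: "f m = complex_of_real (cnorm (f m)) *\<^sub>C e m" if "m < N" for m
    using norm_pos[OF that] by (simp add: e_def)
  have Ue: "U (e m) = cis (\<beta> + real m * \<alpha>) *\<^sub>C e m" for m
    by (simp add: e_def f_def U.scale U_Ap_funpow[OF v(2)])
  have unit: "cinner (e m) (e m) = 1" if "m < N" for m
    using norm_pos[OF that] unfolding e_def by (intro cinner_normalized) simp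
  have distinct: "cis (\<beta> + real j * \<alpha>) \<noteq> cis (\<beta> + real k * \<alpha>)" if "j < N" "k < N" "j \<noteq> k" for j k
  proof -
    have "cis (\<beta> + real k * \<alpha>) \<noteq> cis (\<beta> + real j * \<alpha>)" if "j < k" "k < N" for j k
      using aperiodic[of "k - j"] that
      by (simp add: cis_add_eq_iff of_nat_diff left_diff_distrib)
    with that show ?thesis
      by (metis nat_neq_iff)
  qed
  have orth: "cinner (e j) (e k) = (if j = k then 1 else 0)" if "j < N" "k < N" for j k
    using unit[OF that(1)] eigenvectors_orthogonal[OF Ue Ue distinct[OF that]] by auto
  have r_pos: "0 < r m" if "1 \<le> m" "m < N" for m
    using norm_pos[of m] norm_pos[of "m - 1"] that by (simp add: r_def)
  have Ap_e: "Ap (e m) = complex_of_real (r (m + 1)) *\<^sub>C e (m + 1)" if "m + 1 < N" for m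
  proof -
    have "Ap (e m) = complex_of_real (1 / cnorm (f m)) *\<^sub>C f (m + 1)"
      by (simp add: e_def Ap.scale f_def)
    also have "\<dots> = complex_of_real (1 / cnorm (f m)) *\<^sub>C complex_of_real (cnorm (f (m + 1))) *\<^sub>C e (m + 1)"
      by (rule arg_cong[OF f_e[OF that]])
    finally show ?thesis
      by (simp add: r_def)
  qed
  have Am_e: "Am (e m) = complex_of_real (r m) *\<^sub>C e (m - 1)" if m: "1 \<le> m" "m < N" for m
  proof -
    obtain k where k: "m = k + 1"
      using m(1) by (metis add.commute le_Suc_ex)
    have ap: "Ap (e k) = complex_of_real (r m) *\<^sub>C e m"
      using Ap_e[of k] m k by simp
    \<comment> \<open>The length of \<open>Ap (e k)\<close> identifies the scalar by which
      \<open>Am Ap\<close> acts on \<open>e k\<close> with the square of \<open>r m\<close>; then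
      one factor \<open>r m\<close> cancels.\<close>
    have "complex_of_real ((r m)\<^sup>2) = complex_of_real (C_sqr (\<beta> + real k * \<alpha> + \<alpha>))"
      using cinner_Ap_Ap[OF Ue[of k]] unit[of k] unit[of m] m k
      by (simp add: ap cinner_scaleC_left cinner_scaleC_right power2_eq_square)
    moreover have "complex_of_real (r m) *\<^sub>C Am (e m) = complex_of_real (C_sqr (\<beta> + real k * \<alpha> + \<alpha>)) *\<^sub>C e k"
      using Am_Ap_eigenvector[OF Ue[of k]] by (simp add: ap Am.scale)
    ultimately have "complex_of_real (r m) *\<^sub>C Am (e m) = complex_of_real (r m) *\<^sub>C complex_of_real (r m) *\<^sub>C e k"
      by (simp add: power2_eq_square)
    then have "Am (e m) = complex_of_real (r m) *\<^sub>C e k"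
      by (rule cvec.scale_left_imp_eq[rotated]) (use r_pos[OF m] in simp)
    then show ?thesis
      using k by simp
  qed
  \<comment> \<open>The component along the last vector is the whole of \<open>Am (e 0)\<close>,
    since \<open>bottom\<close> places it on that line.\<close>
  define \<kappa> where "\<kappa> = cinner (e (N - 1)) (Am (e 0))"
  have e0: "e 0 = complex_of_real (1 / cnorm v) *\<^sub>C v" "v = complex_of_real (cnorm v) *\<^sub>C e 0"
    using v(1) cnorm_pos_iff[of v] by (simp_all add: e_def f_def del: cnorm_pos_iff)
  have "Am (e 0) = complex_of_real (1 / cnorm v) *\<^sub>C t' *\<^sub>C f (N - 1)"
    by (simp only: e0(1) Am.scale bottom f_def)
  then have "\<exists>s. Am (e 0) = s *\<^sub>C e (N - 1)"
    using f_e[of "N - 1"] N by (metis cvec.scale_scale diff_less zero_less_one less_le_trans)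
  then have Am_e0: "Am (e 0) = \<kappa> *\<^sub>C e (N - 1)"
    using unit[of "N - 1"] N by (auto simp: \<kappa>_def cinner_scaleC_right)
  have "Ap (f (N - 1)) = t *\<^sub>C v"
    using top N by (cases N) (simp_all add: f_def)
  then have "Ap (e (N - 1)) = complex_of_real (1 / cnorm (f (N - 1))) *\<^sub>C t *\<^sub>C v"
    by (simp only: e_def[of "N - 1"] Ap.scale)
  then have "\<exists>s. Ap (e (N - 1)) = s *\<^sub>C e 0"
    using e0(2) by (metis cvec.scale_scale)
  then obtain s where s: "Ap (e (N - 1)) = s *\<^sub>C e 0"
    by blast
  \<comment> \<open>Adjointness of \<open>Ap\<close> and \<open>Am\<close> ties the coefficient at
    the top to the one at the bottom.\<close>
  have "\<kappa> = cinner (s *\<^sub>C e 0) (e 0)"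
    by (simp only: \<kappa>_def s flip: cinner_Ap)
  then have "\<kappa> = cnj s"
    using unit[of 0] N by (simp add: cinner_scaleC_left)
  then have Ap_eN: "Ap (e (N - 1)) = cnj \<kappa> *\<^sub>C e 0"
    using s by simp
  \<comment> \<open>Indices \<open>0\<close> and \<open>N\<close> belong to the same closing step of
    the chain and share \<open>\<kappa>\<close>.\<close>
  define C where "C m = (if m = 0 \<or> m = N then \<kappa> else complex_of_real (r m))" for m
  have mem: "e m \<in> cvec.span (e ` {..<N})" if "m < N" for m
    using that by (intro cvec.span_base) simp
  have span: "cvec.span (e ` {..<N}) = UNIV"
  proof (rule invariant_span_eq_UNIV)
    fix m
    assume m: "m < N"
    show "Ap (e m) \<in> cvec.span (e ` {..<N})"
      using Ap_e[of m] Ap_eN mem[of "m + 1"] mem[of 0] m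
      by (cases "m + 1 < N") (auto simp: cvec.span_scale dest: less_antisym)
    show "Am (e m) \<in> cvec.span (e ` {..<N})"
      using Am_e[of m] Am_e0 mem[of "m - 1"] mem[of "N - 1"] m
      by (cases "m = 0") (auto simp: cvec.span_scale)
  next
    show "0 < N"
      using N by simp
    show "e 0 \<noteq> 0"
      using unit[of 0] N by auto
  qed
  have "n = card (e ` {..<N})"
    using cvec.dim_span_eq_card_independent[OF orthonormal_independent(2), of N e] orth
    by (simp add: span dim)
  then have "N = n"
    using orthonormal_independent(1)[of N e] orth by (simp add: card_image)
  have Am_C: "Am (e m) = C m *\<^sub>C e (if m = 0 then N - 1 else m - 1)" if "m < N" for m
    using that Am_e[of m] Am_e0 by (simp add: C_def)
  have C_sqr: "(cmod (C m))\<^sup>2 = C_sqr (\<beta> + real m * \<alpha>)" if "m \<le> N" for m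
  \<comment> \<open>There is no vector \<open>e N\<close>, so this value is read off from
    \<open>Ap\<close> at the last vector; all others come from \<open>Am (e m)\<close>.\<close>
  proof (cases "m = N")
    case True
    have "complex_of_real (C_sqr (\<beta> + real (N - 1) * \<alpha> + \<alpha>)) = cinner (Ap (e (N - 1))) (Ap (e (N - 1)))"
      using cinner_Ap_Ap[OF Ue[of "N - 1"]] unit[of "N - 1"] N by simp
    also have "\<dots> = \<kappa> * cnj \<kappa>"
      unfolding Ap_eN using unit[of 0] N by (simp add: cinner_scaleC_left cinner_scaleC_right)
    also have "\<dots> = complex_of_real ((cmod \<kappa>)\<^sup>2)"
      by (simp add: complex_norm_square del: of_real_power)
    finally have "C_sqr (\<beta> + real (N - 1) * \<alpha> + \<alpha>) = (cmod \<kappa>)\<^sup>2"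
      by (simp only: of_real_eq_iff)
    moreover have "\<beta> + real (N - 1) * \<alpha> + \<alpha> = \<beta> + real N * \<alpha>"
      using N by (simp add: of_nat_diff algebra_simps)
    ultimately have "C_sqr (\<beta> + real N * \<alpha>) = (cmod \<kappa>)\<^sup>2"
      by (simp only:)
    then show ?thesis
      using True by (simp add: C_def)
  next
    case False
    with that have m: "m < N"
      by simp
    \<comment> \<open>The cyclic predecessor of \<open>m\<close>, which treats \<open>m = 0\<close>
      together with the rest.\<close>
    define l where "l = (if m = 0 then N - 1 else m - 1)"
    have "l < N"
      using m by (auto simp: l_def)
    then have "complex_of_real (C_sqr (\<beta> + real m * \<alpha>)) = C m * cnj (C m)"
      using cinner_Am_Am[OF Ue[of m]] unit[OF m] unit[of l] m
      by (simp add: Am_C flip: l_def) (simp add: cinner_scaleC_left cinner_scaleC_right mult.commute)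
    also have "\<dots> = complex_of_real ((cmod (C m))\<^sup>2)"
      by (simp add: complex_norm_square del: of_real_power)
    finally show ?thesis
      by (simp only: of_real_eq_iff)
  qed
  have "ladder_basis \<beta> N e C"
    unfolding ladder_basis_def orthonormal_basis_def
    using orth span Ue C_sqr r_pos Am_e Ap_e Am_e0 Ap_eN
    by (auto simp: C_def less_imp_neq[THEN not_sym])
  then show ?thesis
    using \<open>N = n\<close> that by blast
qed

text \<open>After a full turn the iterate is back on the line of \<open>v\<close>, which
  \<open>Am\<close> kills; moving one \<open>Ap\<close> across the inner product makes its length
  zero.\<close>

lemma Ap_funpow_eq_0_if_cis_eq_1:
  assumes "U v = cis \<theta> *\<^sub>C v" "Am v = 0" "0 < j" "cis (real j * \<alpha>) = 1"
  shows "(Ap ^^ j) v = 0"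
proof (cases "v = 0")
  case True
  then show ?thesis
    by (induction j) (simp_all add: Ap.zero)
next
  case False
  obtain i where i: "j = Suc i"
    using assms(3) by (cases j) auto
  have "cis (\<theta> + real j * \<alpha>) = cis \<theta>"
    using cis_add_eq_iff[of \<theta> "real j * \<alpha>" 0] assms(4) by simp
  then obtain t where "(Ap ^^ j) v = t *\<^sub>C v"
    using proportional[OF assms(1) U_Ap_funpow[OF assms(1)] _ False] by metis
  then have "Am ((Ap ^^ j) v) = 0"
    by (simp add: Am.scale assms(2))
  then have "cinner ((Ap ^^ j) v) ((Ap ^^ j) v) = 0"
    by (simp add: i cinner_Ap)
  then show ?thesis
    by simp
qed

lemma ladder_exists:
  obtains \<beta> e C where "ladder_basis \<beta> n e C" "1 \<le> n"
    "\<And>j. 0 < j \<Longrightarrow> j < n \<Longrightarrow> cis (real j * \<alpha>) \<noteq> 1"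
proof (cases "\<exists>v \<theta>. v \<noteq> 0 \<and> U v = cis \<theta> *\<^sub>C v \<and> Am v = 0")
  case True
  then obtain v \<theta> where v: "v \<noteq> 0" "U v = cis \<theta> *\<^sub>C v" "Am v = 0"
    by blast
  \<comment> \<open>A chain that never vanished would repeat an eigenvalue, hence have a period, and
    would then vanish by \<open>Ap_funpow_eq_0_if_cis_eq_1\<close>.\<close>
  have "\<exists>m. (Ap ^^ m) v = 0"
  proof (rule ccontr)
    assume *: "\<not> ?thesis"
    then obtain i j :: nat where ij: "i < j" "cis (\<theta> + real i * \<alpha>) = cis (\<theta> + real j * \<alpha>)"
      using repeated_eigenvalue[of "\<lambda>m. (Ap ^^ m) v" "\<lambda>m. \<theta> + real m * \<alpha>"]
        U_Ap_funpow[OF v(2)] by metis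
    then have "cis (real (j - i) * \<alpha>) = 1"
      using cis_add_eq_iff[of \<theta> "real j * \<alpha>" "real i * \<alpha>"]
      by (simp add: of_nat_diff left_diff_distrib)
    with * ij show False
      using Ap_funpow_eq_0_if_cis_eq_1[OF v(2,3), of "j - i"] by simp
  qed
  then obtain N where N: "(Ap ^^ N) v = 0" "\<And>m. m < N \<Longrightarrow> (Ap ^^ m) v \<noteq> 0"
    using exists_least_iff[of "\<lambda>m. (Ap ^^ m) v = 0"] by blast
  have "1 \<le> N"
    using N(1) v(1) by (cases N) auto
  moreover have aperiodic: "cis (real j * \<alpha>) \<noteq> 1" if "0 < j" "j < N" for j
    using Ap_funpow_eq_0_if_cis_eq_1[OF v(2,3) that(1)] N(2)[OF that(2)] by blast
  moreover have "(Ap ^^ N) v = 0 *\<^sub>C v" "Am v = 0 *\<^sub>C (Ap ^^ (N - 1)) v"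
    using N(1) v(3) by simp_all
  ultimately obtain e C where "ladder_basis \<theta> N e C" "N = n"
    using ladder[OF v(1,2) _ N(2)] by metis
  then show ?thesis
    using that \<open>1 \<le> N\<close> aperiodic by blast
next
  case False
  obtain v c where v: "v \<noteq> 0" "U v = c *\<^sub>C v"
    using eigenvector_exists[OF linear_U fin nontrivial] by blast
  then obtain \<beta> where "c = cis \<beta>"
    by (rule eigenvalue_cis)
  with v have eig: "U v = cis \<beta> *\<^sub>C v"
    by simp
  have Am_nonzero: "(Am ^^ m) w \<noteq> 0" if "w \<noteq> 0" "U w = cis \<theta> *\<^sub>C w" for m w \<theta>
  proof (induction m)
    case (Suc m)
    then show ?case
      using U_Am_funpow[OF that(2), of m] False by auto
  qed (simp add: that)
  obtain i j :: nat where ij: "i < j" "cis (\<beta> - real i * \<alpha>) = cis (\<beta> - real j * \<alpha>)"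
    using repeated_eigenvalue[of "\<lambda>m. (Am ^^ m) v" "\<lambda>m. \<beta> - real m * \<alpha>"]
      U_Am_funpow[OF eig] Am_nonzero[OF v(1) eig] by metis
  then have "cis (real (j - i) * \<alpha>) = 1"
    using cis_add_eq_iff[of \<beta> "- real i * \<alpha>" "- real j * \<alpha>"]
    by (simp add: of_nat_diff algebra_simps)
  then have "\<exists>N. 0 < N \<and> cis (real N * \<alpha>) = 1"
    using ij(1) zero_less_diff by blast
  \<comment> \<open>The least period of the shift becomes the length of the chain.\<close>
  then obtain N where N: "0 < N" "cis (real N * \<alpha>) = 1"
    and aperiodic: "\<And>j. 0 < j \<Longrightarrow> j < N \<Longrightarrow> cis (real j * \<alpha>) \<noteq> 1"
    using exists_least_iff[of "\<lambda>N. 0 < N \<and> cis (real N * \<alpha>) = 1"] by blast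
  have per: "cis (\<theta> - real N * \<alpha>) = cis \<theta>" "cis (\<theta> + real N * \<alpha>) = cis \<theta>" for \<theta>
  proof -
    show *: "cis (\<theta> + real N * \<alpha>) = cis \<theta>" for \<theta>
      using cis_add_eq_iff[of \<theta> "real N * \<alpha>" 0] N(2) by simp
    show "cis (\<theta> - real N * \<alpha>) = cis \<theta>"
      using *[of "\<theta> - real N * \<alpha>"] by simp
  qed
  have Ap_nonzero: "Ap w \<noteq> 0" if w: "w \<noteq> 0" "U w = cis \<theta> *\<^sub>C w" for w \<theta>
  proof
    assume "Ap w = 0"
    \<comment> \<open>One more \<open>Am\<close> completes a full period and returns
      \<open>h\<close> to the line of \<open>w\<close>, which \<open>Ap\<close> kills; by
      adjointness \<open>Am h\<close> is then zero, although \<open>Am\<close> kills no eigenvector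
      here.\<close>
    define h where "h = (Am ^^ (N - 1)) w"
    have h: "U h = cis (\<theta> - real (N - 1) * \<alpha>) *\<^sub>C h"
      unfolding h_def by (rule U_Am_funpow[OF w(2)])
    have Am_h: "Am h = (Am ^^ N) w"
      using N(1) by (cases N) (simp_all add: h_def)
    obtain t where "Am h = t *\<^sub>C w"
      using proportional[OF w(2) U_Am_funpow[OF w(2), of N] _ w(1)] per(1)[of \<theta>] Am_h by metis
    then have "Ap (Am h) = 0"
      using \<open>Ap w = 0\<close> by (simp add: Ap.scale)
    then have "cinner (Am h) (Am h) = 0"
      by (simp add: cinner_Am)
    then show False
      using Am_h Am_nonzero[OF w] by simp
  qed
  have nonzero: "(Ap ^^ m) v \<noteq> 0" for m
  proof (induction m)
    case (Suc m)
    then show ?case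
      using U_Ap_funpow[OF eig, of m] Ap_nonzero by auto
  qed (simp add: v)
  obtain t where t: "(Ap ^^ N) v = t *\<^sub>C v"
    using proportional[OF eig U_Ap_funpow[OF eig, of N] _ v(1)] per(2)[of \<beta>] by metis
  \<comment> \<open>Up to a period, one step below the first vector is the last vector of the
    chain.\<close>
  have "\<beta> + real (N - 1) * \<alpha> = \<beta> - \<alpha> + real N * \<alpha>"
    using N(1) by (simp add: of_nat_diff algebra_simps)
  then have "cis (\<beta> + real (N - 1) * \<alpha>) = cis (\<beta> - \<alpha>)"
    by (simp only: per(2))
  then obtain t' where t': "Am v = t' *\<^sub>C (Ap ^^ (N - 1)) v"
    using proportional[OF U_Ap_funpow[OF eig, of "N - 1"] U_Am_eigenvector[OF eig] _ nonzero]
    by metis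
  have "1 \<le> N"
    using N(1) by simp
  then obtain e C where "ladder_basis \<beta> N e C" "N = n"
    using ladder[OF v(1) eig _ nonzero aperiodic t t'] by metis
  then show ?thesis
    using that \<open>1 \<le> N\<close> aperiodic by blast
qed

text \<open>As \<open>Am (e 0)\<close> is a nonzero multiple of \<open>e (n - 1)\<close>, the
  eigenvalues agree and \<open>n\<close> shifts make whole turns. The bounds on
  \<open>\<alpha>\<close> give those on \<open>k\<close>; a common divisor of \<open>n\<close> and
  \<open>k\<close> would yield a shorter period.\<close>

lemma cyclic_ladder_winding:
  assumes "ladder_basis \<beta> n e C" "1 \<le> n" "C 0 \<noteq> 0"
    and aperiodic: "\<And>j. 0 < j \<Longrightarrow> j < n \<Longrightarrow> cis (real j * \<alpha>) \<noteq> 1"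
  obtains k :: nat where "1 \<le> k" "real k < real n / 2" "coprime n k" "real n * \<alpha> = 2 * pi * real k"
proof -
  have Ue: "U (e m) = cis (\<beta> + real m * \<alpha>) *\<^sub>C e m" if "m < n" for m
    using assms(1) that by (simp add: ladder_basis_def)
  have unit: "cinner (e m) (e m) = 1" if "m < n" for m
    using assms(1) that by (simp add: ladder_basis_def orthonormal_basis_def)
  have Am: "Am (e 0) = C 0 *\<^sub>C e (n - 1)"
    using assms(1) by (simp add: ladder_basis_def)
  have Ue0: "U (e 0) = cis \<beta> *\<^sub>C e 0"
    using Ue[of 0] assms(2) by simp
  have "cis (\<beta> - \<alpha>) = cis (\<beta> + real (n - 1) * \<alpha>)"
  proof (rule ccontr)
    assume "cis (\<beta> - \<alpha>) \<noteq> cis (\<beta> + real (n - 1) * \<alpha>)"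
    then have "cinner (Am (e 0)) (e (n - 1)) = 0"
      using eigenvectors_orthogonal[OF U_Am_eigenvector[OF Ue0] Ue[of "n - 1"]] assms(2) by simp
    then show False
      using unit[of "n - 1"] assms(2,3) by (simp add: Am cinner_scaleC_left)
  qed
  then have "cis (real (n - 1) * \<alpha> - - \<alpha>) = 1"
    using cis_add_eq_iff[of \<beta> "real (n - 1) * \<alpha>" "- \<alpha>"] by simp
  moreover have "real (n - 1) * \<alpha> - - \<alpha> = real n * \<alpha>"
    using assms(2) by (simp add: of_nat_diff algebra_simps)
  ultimately have "cos (real n * \<alpha>) = 1"
    by (simp add: complex_eq_iff)
  then obtain z :: int where z: "real n * \<alpha> = of_int z * 2 * pi"
    using cos_one_2pi_int[of "real n * \<alpha>"] by auto
  have "0 < real n * \<alpha>"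
    using assms(2) alpha(1) by simp
  then have "0 < z"
    using z pi_gt_zero by (simp add: zero_less_mult_iff)
  define k where "k = nat z"
  have k: "1 \<le> k" "real n * \<alpha> = 2 * pi * real k"
    using \<open>0 < z\<close> z by (simp_all add: k_def)
  have "2 * pi * real k < real n * pi"
    using k(2) alpha(2) assms(2) by (metis mult_strict_left_mono of_nat_0_less_iff less_le_trans zero_less_one)
  then have "pi * (2 * real k) < pi * real n"
    by (simp add: algebra_simps)
  then have lt: "real k < real n / 2"
    by (simp only: mult_less_cancel_left_pos[OF pi_gt_zero])
  have "coprime n k"
  proof (rule ccontr)
    assume "\<not> coprime n k"
    moreover define d where "d = gcd n k"
    ultimately have "d \<noteq> 1" "0 < d"
      using k(1) by (simp_all add: coprime_iff_gcd_eq_1)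
    then have d: "1 < d"
      by simp
    obtain n' k' where nk: "n = d * n'" "k = d * k'"
      unfolding d_def by (metis dvdE gcd_dvd1 gcd_dvd2)
    have n': "0 < n'" "n' < n"
      using assms(2) d nk(1) by (auto intro: Nat.gr0I)
    have "real d * (real n' * \<alpha>) = real d * (2 * pi * real k')"
      using k(2) nk by (simp add: mult_ac)
    then have "real n' * \<alpha> = 2 * pi * real k'"
      using d by simp
    then have "cis (real n' * \<alpha>) = 1"
      by (simp add: cis_multiple_2pi)
    with aperiodic n' show False
      by blast
  qed
  with k lt show ?thesis
    using that by blast
qed

end


section \<open>Representations of the algebra\<close>

locale sphere_rep =
  fixes R :: real and \<Psi> :: "falg set \<Rightarrow> 'h::complex_inner \<Rightarrow> 'h"
  assumes rep: "algebra_rep R \<Psi>"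
begin

text \<open>Composing with the quotient map gives a representation of the free algebra, in which
  each relator becomes an operator equation.\<close>

definition op :: "falg \<Rightarrow> 'h \<Rightarrow> 'h"
  where "op p = \<Psi> (cls R p)"

lemma op_ring_hom: "op \<in> ring_hom falg_ring end_ring"
  using ring_hom_trans[OF cls_ring_hom] rep
  by (force simp: algebra_rep_def op_def[abs_def] comp_def)

lemma op_add: "op (p + q) v = op p v + op q v"
  using ring_hom_add[OF op_ring_hom, of p q] by (simp add: falg_ring_def end_ring_def)

lemma op_mult: "op (p * q) v = op p (op q v)"
  using ring_hom_mult[OF op_ring_hom, of p q] by (simp add: falg_ring_def end_ring_def)

lemma op_one: "op 1 v = v"
  using ring_hom_one[OF op_ring_hom] by (simp add: falg_ring_def end_ring_def)

lemma linear_op: "Vector_Spaces.linear scaleC scaleC (op p)"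
  using ring_hom_closed[OF op_ring_hom, of p] by (simp add: falg_ring_def end_ring_def)

lemma op_fconst_mult: "op (fconst c * p) v = c *\<^sub>C op p v"
  using rep by (simp add: algebra_rep_def op_def carrier_alg flip: alg_scale_cls)

lemma op_fconst: "op (fconst c) v = c *\<^sub>C v"
  using op_fconst_mult[of c 1 v] by (simp add: op_one)

lemma op_diff: "op (p - q) v = op p v - op q v"
  using op_add[of "p - q" q v] by simp

lemma op_0: "op 0 v = 0"
  using op_diff[of 0 0 v] by simp

lemma op_rel_ideal:
  assumes "p \<in> rel_ideal R"
  shows "op p v = 0"
proof -
  have "cls R p = cls R 0"
    unfolding cls_eq
  proof safe
    fix h
    assume "h \<in> rel_ideal R"
    then show "\<exists>h'. h + p = h' + 0 \<and> h' \<in> rel_ideal R"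
      using rel_ideal_add assms by (intro exI[of _ "h + p"]) simp
    show "\<exists>h'. h + 0 = h' + p \<and> h' \<in> rel_ideal R"
      using rel_ideal_add[OF \<open>h \<in> rel_ideal R\<close> rel_ideal_uminus[OF assms]]
      by (intro exI[of _ "h + - p"]) simp
  qed
  then show ?thesis
    using op_0 by (simp add: op_def)
qed

lemma op_relator: "p \<in> relators R \<Longrightarrow> op p v = 0"
  using op_rel_ideal relators_in_rel_ideal by blast

text \<open>Words span the free algebra, and a word acts by its letters in turn.\<close>

lemma op_in_invariant_subspace:
  assumes S: "cvec.subspace S" and gens: "\<And>g v. v \<in> S \<Longrightarrow> op (fgen g) v \<in> S" and "v \<in> S"
  shows "op p v \<in> S"
  using \<open>v \<in> S\<close>
proof (induction p rule: falg_induct)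
  case (single w c)
  have "op (Poly_Mapping.single (Word gs) c) v \<in> S" for gs
  proof (induction gs)
    case Nil
    show ?case
      using op_fconst[of c v] cvec.subspace_scale[OF S single] by (simp add: fconst_def zero_word_def)
  next
    case (Cons g gs)
    have "Poly_Mapping.single (Word (g # gs)) c = fgen g * Poly_Mapping.single (Word gs) c"
      by (simp add: fgen_def mult_single plus_word_def)
    then show ?case
      using gens[OF Cons] by (simp add: op_mult)
  qed
  then show ?case
    by (cases w) simp
next
  case (add p q)
  then show ?case
    by (simp add: op_add cvec.subspace_add[OF S])
qed

lemma op_fw: "op (fw R) v = op fx (op fx v) + op fy (op fy v) - complex_of_real R *\<^sub>C v"
  by (simp add: fw_def op_diff op_add op_mult op_fconst)

lemma op_self_adjoint:
  assumes "adjoint_preserving R \<Psi>"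
  shows "cinner (op (fgen g) v) w = cinner v (op (fgen g) w)"
  using assms unfolding adjoint_preserving_def is_hermitian_adjoint_def
  by (metis alg_dagger_cls carrier_alg fstar_fgen op_def rangeI)

end


theorem theorem3:
  fixes R \<epsilon> \<alpha> :: real
    and n :: nat
    and \<Psi> :: "falg set \<Rightarrow> 'h::complex_inner \<Rightarrow> 'h"
  assumes dim: "has_cdim TYPE('h) n"
    and rep: "algebra_rep R \<Psi>"
    and irr: "irreducible_rep R \<Psi>"
    and adj: "adjoint_preserving R \<Psi>"
    and eps_pos: "\<epsilon> > 0"
    and eps: "\<Psi> (alg_eps R) = (\<lambda>v. complex_of_real \<epsilon> *\<^sub>C v)"
    and mult_free: "no_multiple_eigenvalues (\<Psi> (alg_u R))"
    and alpha: "tan (\<alpha> / 2) = \<epsilon>" "0 < \<alpha>" "\<alpha> < pi"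
  shows "\<exists>(\<beta>::real) (e :: nat \<Rightarrow> 'h) (C :: nat \<Rightarrow> complex).
    orthonormal_basis n e \<and>
    (\<forall>m<n. \<Psi> (alg_u R) (e m) = cis (\<beta> + real m * \<alpha>) *\<^sub>C e m) \<and>
    (\<forall>m\<le>n. (cmod (C m))\<^sup>2 = 1 / cos (\<alpha> / 2) * cos (\<beta> - \<alpha> / 2 + real m * \<alpha>) + R) \<and>
    (\<forall>m. 1 \<le> m \<and> m < n \<longrightarrow> C m \<noteq> 0) \<and>
    (\<forall>m. 1 \<le> m \<and> m < n \<longrightarrow> \<Psi> (alg_a_minus R) (e m) = C m *\<^sub>C e (m - 1)) \<and>
    (\<forall>m. m + 1 < n \<longrightarrow> \<Psi> (alg_a_plus R) (e m) = cnj (C (m + 1)) *\<^sub>C e (m + 1)) \<and>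
    ((\<Psi> (alg_a_minus R) (e 0) = 0 \<and> \<Psi> (alg_a_plus R) (e (n - 1)) = 0 \<and>
      C 0 = 0 \<and> C n = 0) \<or>
     (\<Psi> (alg_a_minus R) (e 0) = C 0 *\<^sub>C e (n - 1) \<and>
      \<Psi> (alg_a_plus R) (e (n - 1)) = cnj (C 0) *\<^sub>C e 0 \<and>
      C 0 = C n \<and> C 0 \<noteq> 0 \<and>
      (\<exists>k::nat. 1 \<le> k \<and> real k < real n / 2 \<and> coprime n k \<and>
        real n * \<alpha> = 2 * pi * real k)))"
proof -
  interpret sphere_rep R \<Psi>
    by standard (rule rep)
  have op_eps: "op feps v = complex_of_real \<epsilon> *\<^sub>C v" for v
    using eps by (simp add: op_def alg_eps_def)
  have relator: "op p v = op q v" if "p - q \<in> relators R" for p q v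
    using op_relator[OF that, of v] by (simp add: op_diff)
  interpret sphere_operators "op fx" "op fy" "op fz" "op (fw R)" "\<Psi> (alg_u R)"
    "\<Psi> (alg_a_plus R)" "\<Psi> (alg_a_minus R)" R \<epsilon> \<alpha>
  proof (rule sphere_operators.intro)
    fix v
    show "op fx (op fy v) - op fy (op fx v) = (\<i> * complex_of_real \<epsilon>) *\<^sub>C op fz v"
      using relator[of "fx * fy - fy * fx" "fconst \<i> * feps * fz" v]
      by (simp add: relators_def op_diff op_mult op_fconst op_eps)
    show "op fy (op fz v) - op fz (op fy v) =
        (\<i> * complex_of_real \<epsilon>) *\<^sub>C (op (fw R) (op fx v) + op fx (op (fw R) v))"
      using relator[of "fy * fz - fz * fy" "fconst \<i> * feps * (fw R * fx + fx * fw R)" v]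
      by (simp add: relators_def op_diff op_add op_mult op_fconst op_eps)
    show "op fz (op fx v) - op fx (op fz v) =
        (\<i> * complex_of_real \<epsilon>) *\<^sub>C (op (fw R) (op fy v) + op fy (op (fw R) v))"
      using relator[of "fz * fx - fx * fz" "fconst \<i> * feps * (fw R * fy + fy * fw R)" v]
      by (simp add: relators_def op_diff op_add op_mult op_fconst op_eps)
    show "op fz (op fz v) + op (fw R) (op (fw R) v) = v"
      using relator[of "fz * fz + fw R * fw R" 1 v]
      by (simp add: relators_def op_add op_mult op_one)
    show "\<Psi> (alg_u R) v = op (fw R) v + \<i> *\<^sub>C op fz v"
      using op_add[of "fw R" "fconst \<i> * fz" v] by (simp add: alg_u_def op_fconst_mult flip: op_def)
    show "\<Psi> (alg_a_plus R) v = op fx v + \<i> *\<^sub>C op fy v"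
      using op_add[of fx "fconst \<i> * fy" v]
      by (simp add: alg_a_plus_def op_fconst_mult flip: op_def)
    show "\<Psi> (alg_a_minus R) v = op fx v - \<i> *\<^sub>C op fy v"
      using op_diff[of fx "fconst \<i> * fy" v]
      by (simp add: alg_a_minus_def op_fconst_mult flip: op_def)
  qed (use linear_op op_self_adjoint[OF adj] op_fw alpha in auto)
  obtain B :: "'h set" where B: "finite B" "cvec.span B = UNIV"
    using dim by (auto simp: has_cdim_def)
  interpret irreducible_sphere_operators "op fx" "op fy" "op fz" "op (fw R)" "\<Psi> (alg_u R)"
    "\<Psi> (alg_a_plus R)" "\<Psi> (alg_a_minus R)" R \<epsilon> \<alpha> n B
  proof
    show "finite B" "cvec.span B = UNIV" "cvec.dim (UNIV :: 'h set) = n" "(UNIV :: 'h set) \<noteq> {0}"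
      "no_multiple_eigenvalues (\<Psi> (alg_u R))"
      using B dim irr mult_free by (simp_all add: has_cdim_def irreducible_rep_def)
  next
    fix S
    assume S: "cvec.subspace S" and x: "op fx ` S \<subseteq> S" and y: "op fy ` S \<subseteq> S"
    \<comment> \<open>\<open>Z\<close> is recovered from the commutator of \<open>X\<close> and
      \<open>Y\<close> by dividing by \<open>\<i> * \<epsilon>\<close>; the last two generators act
      as scalars.\<close>
    have "op (fgen g) v \<in> S" if "v \<in> S" for g v
    proof (cases g)
      case GX
      then show ?thesis
        using x that by auto
    next
      case GY
      then show ?thesis
        using y that by auto
    next
      case GZ
      have "op fz v = (1 / (\<i> * complex_of_real \<epsilon>)) *\<^sub>C (op fx (op fy v) - op fy (op fx v))"
        using eps_pos by (simp add: comm_XY)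
      moreover have "op fx (op fy v) - op fy (op fx v) \<in> S"
        by (rule cvec.subspace_diff[OF S]) (use x y that in auto)
      ultimately show ?thesis
        using GZ cvec.subspace_scale[OF S] by simp
    next
      case GE
      then show ?thesis
        using cvec.subspace_scale[OF S that] by (simp add: op_eps)
    next
      case GI
      have "complex_of_real (1 + \<epsilon>\<^sup>2) *\<^sub>C op finv v = v"
        using relator[of "(1 + feps * feps) * finv" 1 v]
        by (simp add: relators_def op_add op_mult op_one op_eps cvec.scale_left_distrib power2_eq_square)
      moreover have "1 + \<epsilon>\<^sup>2 \<noteq> 0"
        using zero_le_power2[of \<epsilon>] by linarith
      ultimately have "op finv v = complex_of_real (1 / (1 + \<epsilon>\<^sup>2)) *\<^sub>C v"
        by (metis cvec.scale_one cvec.scale_scale nonzero_eq_divide_eq of_real_1 of_real_mult)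
      then show ?thesis
        using GI cvec.subspace_scale[OF S that] by simp
    qed
    then have "op p v \<in> S" if "v \<in> S" for p v
      using op_in_invariant_subspace[OF S _ that] by blast
    then have "\<forall>a\<in>carrier (alg R). \<Psi> a ` S \<subseteq> S"
      by (auto simp: carrier_alg op_def)
    then show "S = {0} \<or> S = UNIV"
      using irr S by (simp add: irreducible_rep_def)
  qed
  obtain \<beta> e C where ladder: "ladder_basis \<beta> n e C" and "1 \<le> n"
    and aperiodic: "\<And>j. 0 < j \<Longrightarrow> j < n \<Longrightarrow> cis (real j * \<alpha>) \<noteq> 1"
    using ladder_exists by blast
  have "\<exists>k::nat. 1 \<le> k \<and> real k < real n / 2 \<and> coprime n k \<and> real n * \<alpha> = 2 * pi * real k"
    if "C 0 \<noteq> 0"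
    using cyclic_ladder_winding[OF ladder \<open>1 \<le> n\<close> that aperiodic] by metis
  moreover have "C_sqr (\<beta> + real m * \<alpha>) = 1 / cos (\<alpha> / 2) * cos (\<beta> - \<alpha> / 2 + real m * \<alpha>) + R" for m
    by (simp add: C_sqr_def algebra_simps)
  ultimately show ?thesis
    using ladder unfolding ladder_basis_def
    \<comment> \<open>Vanishing of \<open>C 0\<close>, which equals \<open>C n\<close>, decides
      between the two alternatives.\<close>
    by (intro exI[of _ \<beta>] exI[of _ e] exI[of _ C]) (cases "C 0 = 0"; simp)
qed

end
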